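(* Let $K:\ell^2\to H_2$ be linear and bounded, $1\le q\le2$, and let $J:\ell^2\to\mathbb{R}\cup\{\infty\}$ be $J(u)=\sum_{k\in\mathbb{N}}|u_k|^q$ if $u\in\ell^q$ and $J(u)=+\infty$ otherwise. Let $\delta_k>0$, $\delta_k\to0$, and $g_k\in H_2$ with $\|g_k-g\|\le\delta_k$. Let the parameter choice $\Gamma:(0,\infty)\times H_2\to\mathbb{N}$ satisfy $$\lim_{k\to\infty}\delta_k^2\,t_{\Gamma(\delta_k,g_k)}=0\quad\text{and}\quad\lim_{k\to\infty}t_{\Gamma(\delta_k,g_k)}=+\infty .$$ Then the sequence $\{\mathcal{R}_{\Gamma(\delta_k,g_k)}(g_k)\}_{k}$ has a subsequence which converges strongly (in $\ell^2$) to a $J$-minimizing solution of $Ku=g$.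
   Context: $H_2$ is a separable (real) Hilbert space and $H_1=\ell^2$. The element $g\in H_2$ is attainable: $Ku=g$ for some $u$ with $J(u)<\infty$. A $J$-minimizing solution of $Ku=g$ is a minimizer of $J(u)$ subject to $Ku=g$. Augmented Lagrangian method: $\{\tau_n\}_{n\ge1}$ is a fixed sequence of positive numbers, $t_n:=\sum_{k=1}^n\tau_k$, with $t_n\to+\infty$ and $\sup_k\tau_k<\infty$. Given data $g^\delta$ and a fixed starting element $p_0^\delta=p_0\in H_2$, for $n=1,2,\dots$ $$u_n^\delta\in\operatorname{argmin}_{u\in\ell^2}\Big(\tfrac{\tau_n}{2}\|Ku-g^\delta\|^2+J(u)-\langle p_{n-1}^\delta,Ku-g^\delta\rangle\Big),\qquad p_n^\delta=p_{n-1}^\delta+\tau_n(g^\delta-Ku_n^\delta).$$ Set $\mathcal{R}_n(g^\delta):=u_n^\delta$. *)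

theory Defs
  imports "HOL-Analysis.Analysis"
begin

section \<open>The Hilbert space of square-summable real sequences\<close>

typedef ell2 = "{f :: nat \<Rightarrow> real. summable (\<lambda>k. (f k)\<^sup>2)}"
  morphisms ell2_nth Abs_ell2
  by (rule exI[of _ "\<lambda>_. 0"]) simp

setup_lifting type_definition_ell2

lemma summable_ell2_nth_square: "summable (\<lambda>k. (ell2_nth u k)\<^sup>2)"
  using ell2_nth[of u] by simp

lemma ell2_eqI: "(\<And>k. ell2_nth u k = ell2_nth v k) \<Longrightarrow> u = v"
  by (simp add: ell2_nth_inject[symmetric] fun_eq_iff)

lemma summable_square_mult:
  fixes f g :: "nat \<Rightarrow> real"
  assumes "summable (\<lambda>k. (f k)\<^sup>2)" "summable (\<lambda>k. (g k)\<^sup>2)"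
  shows "summable (\<lambda>k. f k * g k)"
proof (rule summable_comparison_test')
  show "summable (\<lambda>k. (f k)\<^sup>2 + (g k)\<^sup>2)"
    using assms by (rule summable_add)
  fix k :: nat
  have "2 * \<bar>f k * g k\<bar> \<le> (f k)\<^sup>2 + (g k)\<^sup>2"
    using sum_squares_bound[of "\<bar>f k\<bar>" "\<bar>g k\<bar>"] by (simp add: abs_mult)
  moreover have "0 \<le> \<bar>f k * g k\<bar>"
    by simp
  ultimately show "norm (f k * g k) \<le> (f k)\<^sup>2 + (g k)\<^sup>2"
    unfolding real_norm_def by linarith
qed

lemma summable_square_add:
  fixes f g :: "nat \<Rightarrow> real"
  assumes "summable (\<lambda>k. (f k)\<^sup>2)" "summable (\<lambda>k. (g k)\<^sup>2)"
  shows "summable (\<lambda>k. (f k + g k)\<^sup>2)"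
proof -
  have "summable (\<lambda>k. (f k)\<^sup>2 + (g k)\<^sup>2 + 2 * (f k * g k))"
    by (intro summable_add summable_mult assms summable_square_mult)
  then show ?thesis
    by (simp add: power2_sum mult.assoc)
qed

instantiation ell2 :: real_vector
begin

lift_definition zero_ell2 :: ell2 is "\<lambda>_. 0"
  by simp

lift_definition plus_ell2 :: "ell2 \<Rightarrow> ell2 \<Rightarrow> ell2" is "\<lambda>f g k. f k + g k"
  by (rule summable_square_add)

lift_definition uminus_ell2 :: "ell2 \<Rightarrow> ell2" is "\<lambda>f k. - f k"
  by simp

lift_definition minus_ell2 :: "ell2 \<Rightarrow> ell2 \<Rightarrow> ell2" is "\<lambda>f g k. f k - g k"
  subgoal for f g
    using summable_square_add[of f "\<lambda>k. - g k"] by simp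
  done

lift_definition scaleR_ell2 :: "real \<Rightarrow> ell2 \<Rightarrow> ell2" is "\<lambda>r f k. r * f k"
  by (simp add: power_mult_distrib summable_mult)

instance
  by standard (transfer; simp add: fun_eq_iff algebra_simps)+

end

instantiation ell2 :: real_inner
begin

lift_definition inner_ell2 :: "ell2 \<Rightarrow> ell2 \<Rightarrow> real" is "\<lambda>f g. \<Sum>k. f k * g k" .

definition norm_ell2 :: "ell2 \<Rightarrow> real"
  where "norm_ell2 u = sqrt (inner u u)"

definition sgn_ell2 :: "ell2 \<Rightarrow> ell2"
  where "sgn_ell2 u = u /\<^sub>R norm u"

definition dist_ell2 :: "ell2 \<Rightarrow> ell2 \<Rightarrow> real"
  where "dist_ell2 u v = norm (u - v)"

definition uniformity_ell2 :: "(ell2 \<times> ell2) filter"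
  where "uniformity_ell2 = (INF e\<in>{0<..}. principal {(u, v). dist u v < e})"

definition open_ell2 :: "ell2 set \<Rightarrow> bool"
  where "open_ell2 S = (\<forall>u\<in>S. \<forall>\<^sub>F (u', v) in uniformity. u' = u \<longrightarrow> v \<in> S)"

instance
proof
  fix u v w :: ell2 and r :: real
  show "dist u v = norm (u - v)"
    by (rule dist_ell2_def)
  show "sgn u = u /\<^sub>R norm u"
    by (rule sgn_ell2_def)
  show "(uniformity :: (ell2 \<times> ell2) filter) = (INF e\<in>{0<..}. principal {(x, y). dist x y < e})"
    by (rule uniformity_ell2_def)
  show "open S = (\<forall>x\<in>S. \<forall>\<^sub>F (x', y) in uniformity. x' = x \<longrightarrow> y \<in> S)" for S :: "ell2 set"
    by (rule open_ell2_def)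
  show "inner u v = inner v u"
    by transfer (simp add: mult.commute)
  show "inner (u + v) w = inner u w + inner v w"
    by transfer (simp add: distrib_right suminf_add summable_square_mult)
  show "inner (r *\<^sub>R u) v = r * inner u v"
    by transfer (simp add: mult.assoc suminf_mult summable_square_mult)
  show "0 \<le> inner u u"
    by transfer (simp add: suminf_nonneg power2_eq_square)
  show "inner u u = 0 \<longleftrightarrow> u = 0"
    by transfer (simp add: suminf_eq_zero_iff power2_eq_square fun_eq_iff)
  show "norm u = sqrt (inner u u)"
    by (rule norm_ell2_def)
qed

end

lemma norm_ell2_square: "(norm (u :: ell2))\<^sup>2 = (\<Sum>k. (ell2_nth u k)\<^sup>2)"
  unfolding power2_norm_eq_inner by transfer (simp add: power2_eq_square)

lemma sum_ell2_nth_le: "(\<Sum>k<n. (ell2_nth u k)\<^sup>2) \<le> (norm u)\<^sup>2"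
  unfolding norm_ell2_square
  by (rule sum_le_suminf) (auto simp: summable_ell2_nth_square)

lemma abs_ell2_nth_le: "\<bar>ell2_nth u k\<bar> \<le> norm u"
proof (rule power2_le_imp_le)
  have "(ell2_nth u k)\<^sup>2 \<le> (\<Sum>j<Suc k. (ell2_nth u j)\<^sup>2)"
    by (simp add: sum_nonneg)
  also have "\<dots> \<le> (norm u)\<^sup>2"
    by (rule sum_ell2_nth_le)
  finally show "\<bar>ell2_nth u k\<bar>\<^sup>2 \<le> (norm u)\<^sup>2"
    by simp
qed simp

instance ell2 :: complete_space
proof
  fix X :: "nat \<Rightarrow> ell2"
  assume "Cauchy X"
  define L where "L k = lim (\<lambda>n. ell2_nth (X n) k)" for k
  have L: "(\<lambda>n. ell2_nth (X n) k) \<longlonglongrightarrow> L k" for k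
  proof -
    have "Cauchy (\<lambda>n. ell2_nth (X n) k)"
    proof (rule metric_CauchyI)
      fix e :: real
      assume "0 < e"
      then obtain M where M: "\<And>m n. m \<ge> M \<Longrightarrow> n \<ge> M \<Longrightarrow> dist (X m) (X n) < e"
        using \<open>Cauchy X\<close> metric_CauchyD by blast
      have "dist (ell2_nth (X m) k) (ell2_nth (X n) k) < e" if "m \<ge> M" "n \<ge> M" for m n
        using M[OF that] abs_ell2_nth_le[of "X m - X n" k]
        by (simp add: dist_norm minus_ell2.rep_eq)
      then show "\<exists>M. \<forall>m\<ge>M. \<forall>n\<ge>M. dist (ell2_nth (X m) k) (ell2_nth (X n) k) < e"
        by blast
    qed
    then show ?thesis
      unfolding L_def by (simp add: Cauchy_convergent_iff convergent_LIMSEQ_iff)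
  qed
  have tail: "\<exists>M. \<forall>m\<ge>M. \<forall>N. (\<Sum>k<N. (ell2_nth (X m) k - L k)\<^sup>2) \<le> e\<^sup>2" if "e > 0" for e
  proof -
    obtain M where M: "\<And>m n. m \<ge> M \<Longrightarrow> n \<ge> M \<Longrightarrow> dist (X m) (X n) < e"
      using \<open>Cauchy X\<close> \<open>e > 0\<close> metric_CauchyD by blast
    have "(\<Sum>k<N. (ell2_nth (X m) k - L k)\<^sup>2) \<le> e\<^sup>2" if "m \<ge> M" for m N
    proof (rule LIMSEQ_le_const2)
      show "(\<lambda>n. \<Sum>k<N. (ell2_nth (X m) k - ell2_nth (X n) k)\<^sup>2)
          \<longlonglongrightarrow> (\<Sum>k<N. (ell2_nth (X m) k - L k)\<^sup>2)"
        by (intro tendsto_intros L)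
      have "(\<Sum>k<N. (ell2_nth (X m) k - ell2_nth (X n) k)\<^sup>2) \<le> e\<^sup>2" if "n \<ge> M" for n
      proof -
        have "(\<Sum>k<N. (ell2_nth (X m) k - ell2_nth (X n) k)\<^sup>2) \<le> (norm (X m - X n))\<^sup>2"
          using sum_ell2_nth_le[of "X m - X n" N] by (simp add: minus_ell2.rep_eq)
        also have "\<dots> \<le> e\<^sup>2"
          using M[OF \<open>m \<ge> M\<close> that] by (intro power_mono) (auto simp: dist_norm)
        finally show ?thesis .
      qed
      then show "\<exists>n0. \<forall>n\<ge>n0. (\<Sum>k<N. (ell2_nth (X m) k - ell2_nth (X n) k)\<^sup>2) \<le> e\<^sup>2"
        by blast
    qed
    then show ?thesis
      by blast
  qed
  obtain M1 where M1: "\<And>N. (\<Sum>k<N. (ell2_nth (X M1) k - L k)\<^sup>2) \<le> 1\<^sup>2"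
    using tail[of 1] by auto
  have "summable (\<lambda>k. (ell2_nth (X M1) k - L k)\<^sup>2)"
    by (rule bounded_imp_summable[where B = 1])
      (use M1[of "Suc _"] in \<open>auto simp: lessThan_Suc_atMost\<close>)
  then have "summable (\<lambda>k. (- (ell2_nth (X M1) k - L k))\<^sup>2)"
    by (simp only: power2_minus)
  then have "summable (\<lambda>k. (ell2_nth (X M1) k + - (ell2_nth (X M1) k - L k))\<^sup>2)"
    by (intro summable_square_add summable_ell2_nth_square)
  then have "summable (\<lambda>k. (L k)\<^sup>2)"
    by simp
  then have nth_L: "ell2_nth (Abs_ell2 L) = L"
    by (simp add: Abs_ell2_inverse)
  have "X \<longlonglongrightarrow> Abs_ell2 L"
  proof (rule metric_LIMSEQ_I)
    fix e :: real
    assume "0 < e"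
    then obtain M where M: "\<And>m N. m \<ge> M \<Longrightarrow> (\<Sum>k<N. (ell2_nth (X m) k - L k)\<^sup>2) \<le> (e / 2)\<^sup>2"
      using tail[of "e / 2"] by auto
    have "dist (X m) (Abs_ell2 L) < e" if "m \<ge> M" for m
    proof -
      have "(norm (X m - Abs_ell2 L))\<^sup>2 \<le> (e / 2)\<^sup>2"
        unfolding norm_ell2_square
        by (rule suminf_le_const[OF summable_ell2_nth_square])
          (use M[OF that] in \<open>simp add: minus_ell2.rep_eq nth_L\<close>)
      then have "norm (X m - Abs_ell2 L) \<le> e / 2"
        by (rule power2_le_imp_le) (use \<open>0 < e\<close> in simp)
      then show ?thesis
        using \<open>0 < e\<close> by (simp add: dist_norm)
    qed
    then show "\<exists>M. \<forall>m\<ge>M. dist (X m) (Abs_ell2 L) < e"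
      by blast
  qed
  then show "convergent X"
    by (rule convergentI)
qed

instance ell2 :: banach ..


section \<open>The augmented Lagrangian method\<close>

definition lq_functional :: "real \<Rightarrow> ell2 \<Rightarrow> ereal"
  where "lq_functional q u =
    (if summable (\<lambda>k. \<bar>ell2_nth u k\<bar> powr q)
     then ereal (\<Sum>k. \<bar>ell2_nth u k\<bar> powr q) else \<infinity>)"

definition attainable :: "('a \<Rightarrow> 'b) \<Rightarrow> ('a \<Rightarrow> ereal) \<Rightarrow> 'b \<Rightarrow> bool"
  where "attainable K J g \<longleftrightarrow> (\<exists>u. K u = g \<and> J u < \<infinity>)"

definition J_minimizing_solution :: "('a \<Rightarrow> 'b) \<Rightarrow> ('a \<Rightarrow> ereal) \<Rightarrow> 'b \<Rightarrow> 'a \<Rightarrow> bool"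
  where "J_minimizing_solution K J g u \<longleftrightarrow> is_arg_min J (\<lambda>v. K v = g) u"

definition augmented_Lagrangian ::
    "('a \<Rightarrow> 'b::real_inner) \<Rightarrow> ('a \<Rightarrow> ereal) \<Rightarrow> real \<Rightarrow> 'b \<Rightarrow> 'b \<Rightarrow> 'a \<Rightarrow> ereal"
  where "augmented_Lagrangian K J \<tau> f p u =
    ereal (\<tau> / 2 * (norm (K u - f))\<^sup>2) + J u - ereal (inner p (K u - f))"

text \<open>
  The primal iterates are indexed from 1; the entry \<open>u 0\<close> carries no meaning and is
  unconstrained. Minimizers need not be unique, so the iteration is a relation.
\<close>

definition ALM_iterates ::
    "('a \<Rightarrow> 'b::real_inner) \<Rightarrow> ('a \<Rightarrow> ereal) \<Rightarrow> (nat \<Rightarrow> real) \<Rightarrow> 'b \<Rightarrow> 'b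
      \<Rightarrow> (nat \<Rightarrow> 'a) \<Rightarrow> (nat \<Rightarrow> 'b) \<Rightarrow> bool"
  where "ALM_iterates K J \<tau> p0 f u p \<longleftrightarrow>
    p 0 = p0 \<and>
    (\<forall>n\<ge>1. is_arg_min (augmented_Lagrangian K J (\<tau> n) f (p (n - 1))) (\<lambda>_. True) (u n) \<and>
           p n = p (n - 1) + \<tau> n *\<^sub>R (f - K (u n)))"

text \<open>
  \<open>R n f\<close> is the \<open>n\<close>-th primal iterate for data \<open>f\<close>, for some (arbitrary) selection of the
  minimizers; the starting element \<open>p0\<close> is the same for all data.
\<close>

definition ALM_regularization ::
    "('a \<Rightarrow> 'b::real_inner) \<Rightarrow> ('a \<Rightarrow> ereal) \<Rightarrow> (nat \<Rightarrow> real) \<Rightarrow> 'b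
      \<Rightarrow> (nat \<Rightarrow> 'b \<Rightarrow> 'a) \<Rightarrow> bool"
  where "ALM_regularization K J \<tau> p0 R \<longleftrightarrow>
    (\<forall>f. \<exists>p. ALM_iterates K J \<tau> p0 f (\<lambda>n. R n f) p)"

definition ALM_time :: "(nat \<Rightarrow> real) \<Rightarrow> nat \<Rightarrow> real"
  where "ALM_time \<tau> n = (\<Sum>k=1..n. \<tau> k)"

end

theory Submission
  imports Defs
begin

text \<open>
  The multipliers \<open>p\<^sub>n\<close> are proximal point iterates for the dual functional, whose negative
  subgradient at \<open>p\<^sub>n\<close> is the residual \<open>r\<^sub>n = f - K u\<^sub>n\<close>. Comparing with \<open>0\<close> gives
  \<open>\<parallel>p\<^sub>n\<parallel>\<^sup>2 = O(t\<^sub>n)\<close> as long as \<open>\<delta>\<^sup>2 t\<^sub>n\<close> stays bounded; comparing with an almost optimal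
  dual point, which exists because the method run with exact data produces one, gives
  \<open>t\<^sub>n \<parallel>r\<^sub>n\<parallel>\<^sup>2 \<rightarrow> 0\<close>. Hence \<open>\<langle>p\<^sub>n, r\<^sub>n\<rangle> \<rightarrow> 0\<close> and \<open>\<delta> \<parallel>p\<^sub>n\<parallel> \<rightarrow> 0\<close>, so that
  \<open>K u\<^sub>n \<rightarrow> g\<close> and \<open>limsup J(u\<^sub>n) \<le> min {J(u) | K u = g}\<close>. A weakly convergent subsequence then has
  a minimizing solution as its limit and converges strongly by the Radon-Riesz property of the
  \<open>q\<close>-norm.
\<close>

section \<open>Estimates for the augmented Lagrangian method\<close>

text \<open>Convexity of the epigraph, which avoids arithmetic with infinite values.\<close>

definition ereal_convex :: "('a::real_vector \<Rightarrow> ereal) \<Rightarrow> bool"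
  where "ereal_convex J \<longleftrightarrow>
    (\<forall>u v a b s. J u \<le> ereal a \<longrightarrow> J v \<le> ereal b \<longrightarrow> 0 \<le> s \<longrightarrow> s \<le> 1 \<longrightarrow>
      J ((1 - s) *\<^sub>R u + s *\<^sub>R v) \<le> ereal ((1 - s) * a + s * b))"

text \<open>Divide by \<open>s\<close> and let \<open>s\<close> decrease to 0. This turns minimality
  along a segment into a first-order condition.\<close>

lemma nonneg_if_quadratic_perturbation_nonneg:
  fixes a b :: real
  assumes "\<And>s. 0 < s \<Longrightarrow> s \<le> 1 \<Longrightarrow> 0 \<le> s * a + s\<^sup>2 * b"
  shows "0 \<le> a"
proof (rule tendsto_lowerbound)
  show "((\<lambda>s. a + s * b) \<longlongrightarrow> a) (at_right 0)"
    by (auto intro!: tendsto_eq_intros)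
  have "0 \<le> a + s * b" if "0 < s" "s < 1" for s
  proof -
    have "0 \<le> s * (a + s * b)"
      using assms[of s] that by (simp add: algebra_simps power2_eq_square)
    then show ?thesis
      using that by (simp add: zero_le_mult_iff)
  qed
  then show "\<forall>\<^sub>F s in at_right 0. 0 \<le> a + s * b"
    by (auto simp: eventually_at_right[of 0 1] intro!: exI[of _ 1])
qed simp

lemma inner_diff_ge:
  fixes x y :: "'a::real_inner"
  shows "(norm x)\<^sup>2 - (norm y)\<^sup>2 \<le> 2 * inner x (x - y)"
proof -
  have "0 \<le> (norm (x - y))\<^sup>2" by simp
  then show ?thesis
    by (simp add: power2_norm_eq_inner inner_diff_left inner_diff_right inner_commute)
qed

lemma tendsto_zero_if_square_le:
  fixes x y :: "'a \<Rightarrow> real"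
  assumes "\<forall>\<^sub>F k in F. (x k)\<^sup>2 \<le> y k" and "(y \<longlongrightarrow> 0) F"
  shows "(x \<longlongrightarrow> 0) F"
proof (rule tendsto_0_le[where K = 1])
  show "((\<lambda>k. sqrt (y k)) \<longlongrightarrow> 0) F"
    using tendsto_real_sqrt[OF assms(2)] by simp
  show "\<forall>\<^sub>F k in F. norm (x k) \<le> norm (sqrt (y k)) * 1"
    using assms(1)
  proof eventually_elim
    case (elim k)
    then have "\<bar>x k\<bar> \<le> sqrt (y k)"
      by (simp add: real_le_rsqrt)
    then show ?case by simp
  qed
qed

lemma ALM_time_0 [simp]: "ALM_time \<tau> 0 = 0"
  by (simp add: ALM_time_def)

lemma ALM_time_Suc [simp]: "ALM_time \<tau> (Suc n) = ALM_time \<tau> n + \<tau> (Suc n)"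
  by (simp add: ALM_time_def)

section \<open>A single run with fixed data: optimality, monotonicity and dual estimates\<close>

locale ALM =
  fixes K :: "'a::real_vector \<Rightarrow> 'b::real_inner" and J :: "'a \<Rightarrow> ereal"
    and \<tau> :: "nat \<Rightarrow> real" and p0 f :: 'b and u :: "nat \<Rightarrow> 'a" and p :: "nat \<Rightarrow> 'b"
  assumes linear: "linear K"
    and convex: "ereal_convex J"
    and nonneg: "\<And>v. 0 \<le> J v"
    and proper: "\<exists>v. J v < \<infinity>"
    and step_pos: "\<And>n. 1 \<le> n \<Longrightarrow> 0 < \<tau> n"
    and iterates: "ALM_iterates K J \<tau> p0 f u p"
begin

definition cost :: "nat \<Rightarrow> real"
  where "cost n = real_of_ereal (J (u n))"

definition res :: "nat \<Rightarrow> 'b"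
  where "res n = f - K (u n)"

text \<open>For \<open>n \<ge> 1\<close> this is the value at \<open>p n\<close> of the dual
  functional, the supremum over \<open>v\<close> of \<open>inner (p n) (K v - f) - J v\<close>. By
  \<open>subgradient\<close>, it is attained at \<open>u n\<close>, which gives the closed
  form.\<close>

definition dual :: "nat \<Rightarrow> real"
  where "dual n = - cost n - inner (p n) (res n)"

lemma p_0: "p 0 = p0"
  using iterates by (simp add: ALM_iterates_def)

lemma p_Suc: "p (Suc n) = p n + \<tau> (Suc n) *\<^sub>R res (Suc n)"
  using iterates unfolding ALM_iterates_def res_def
  by (metis One_nat_def diff_Suc_1 le_add1 plus_1_eq_Suc)

lemma argmin:
  "augmented_Lagrangian K J (\<tau> (Suc n)) f (p n) (u (Suc n))
    \<le> augmented_Lagrangian K J (\<tau> (Suc n)) f (p n) v"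
proof -
  have "is_arg_min (augmented_Lagrangian K J (\<tau> (Suc n)) f (p (Suc n - 1))) (\<lambda>_. True) (u (Suc n))"
    using iterates unfolding ALM_iterates_def by (metis le_add1 plus_1_eq_Suc)
  then show ?thesis
    by (auto simp: is_arg_min_def not_less)
qed

text \<open>Comparison with a point of finite penalty makes the minimal value finite. The index
  starts at 1 because \<open>u 0\<close> is unconstrained.\<close>

lemma cost: "J (u (Suc n)) = ereal (cost (Suc n))"
proof -
  obtain v where "J v < \<infinity>" using proper by blast
  then obtain b where "J v = ereal b"
    using nonneg[of v] by (cases "J v") auto
  then show ?thesis
    using argmin[of n v] nonneg[of "u (Suc n)"] unfolding cost_def augmented_Lagrangian_def
    by (cases "J (u (Suc n))") auto
qed

lemma argmin_real:
  assumes "J v \<le> ereal b"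
  shows "\<tau> (Suc n) / 2 * (norm (res (Suc n)))\<^sup>2 + cost (Suc n) + inner (p n) (res (Suc n))
    \<le> \<tau> (Suc n) / 2 * (norm (f - K v))\<^sup>2 + b + inner (p n) (f - K v)"
proof -
  obtain b' where b': "J v = ereal b'" "b' \<le> b"
    using nonneg[of v] assms by (cases "J v") auto
  show ?thesis
    using argmin[of n v] b' unfolding augmented_Lagrangian_def res_def cost
    by (simp add: norm_minus_commute[of f] inner_diff_right)
qed

text \<open>First-order optimality: compare \<open>u (Suc n)\<close> with points of the segment
  towards \<open>v\<close>. The derivative of the quadratic term is absorbed by the multiplier
  update, so that the new multiplier \<open>p (Suc n)\<close> appears in place of
  \<open>p n\<close>.\<close>

lemma subgradient:
  assumes v: "J v \<le> ereal b"
  shows "cost (Suc n) + inner (p (Suc n)) (K v - K (u (Suc n))) \<le> b"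
proof -
  let ?w = "K v - K (u (Suc n))"
  have "0 \<le> s * (b - cost (Suc n) - inner (p (Suc n)) ?w) + s\<^sup>2 * (\<tau> (Suc n) / 2 * (norm ?w)\<^sup>2)"
    if s: "0 < s" "s \<le> 1" for s
  proof -
    let ?v = "(1 - s) *\<^sub>R u (Suc n) + s *\<^sub>R v"
    have "J ?v \<le> ereal ((1 - s) * cost (Suc n) + s * b)"
      using convex s v cost[of n] unfolding ereal_convex_def by simp
    note min = argmin_real[OF this, of n]
    have 1: "f - K ?v = res (Suc n) - s *\<^sub>R ?w"
      by (simp add: res_def linear_add[OF linear] linear_diff[OF linear] linear_scale[OF linear] algebra_simps)
    have 2: "(norm (res (Suc n) - s *\<^sub>R ?w))\<^sup>2 =
        (norm (res (Suc n)))\<^sup>2 - 2 * s * inner (res (Suc n)) ?w + s\<^sup>2 * (norm ?w)\<^sup>2"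
      by (simp only: power2_norm_eq_inner)
        (simp add: inner_diff_left inner_diff_right inner_commute power2_eq_square algebra_simps)
    have 3: "inner (p (Suc n)) ?w = inner (p n) ?w + \<tau> (Suc n) * inner (res (Suc n)) ?w"
      by (simp add: p_Suc inner_add_left)
    have 4: "inner (p n) (res (Suc n) - s *\<^sub>R ?w) =
        inner (p n) (res (Suc n)) - s * inner (p n) ?w"
      by (simp add: inner_diff_right)
    show ?thesis
      using min unfolding 1 2 3 4 by (simp add: distrib_left distrib_right left_diff_distrib right_diff_distrib field_simps)
  qed
  from nonneg_if_quadratic_perturbation_nonneg[OF this] show ?thesis by simp
qed

text \<open>Subgradients are monotone: adding two consecutive subgradient inequalities cancels the
  costs, and the multipliers differ by a positive multiple of the newer residual.\<close>

lemma norm_res_antimono: "norm (res (Suc (Suc n))) \<le> norm (res (Suc n))"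
proof -
  let ?r = "res (Suc n)" and ?r' = "res (Suc (Suc n))"
  have diff: "K (u (Suc n)) - K (u (Suc (Suc n))) = ?r' - ?r"
    "K (u (Suc (Suc n))) - K (u (Suc n)) = ?r - ?r'"
    by (simp_all add: res_def)
  have "inner (p (Suc (Suc n))) (?r' - ?r) + inner (p (Suc n)) (?r - ?r') \<le> 0"
    using subgradient[of "u (Suc n)" "cost (Suc n)" "Suc n"]
      subgradient[of "u (Suc (Suc n))" "cost (Suc (Suc n))" n]
    by (simp add: cost diff)
  then have "\<tau> (Suc (Suc n)) * inner ?r' (?r' - ?r) \<le> 0"
    by (simp add: p_Suc[of "Suc n"] inner_add_left inner_diff_right algebra_simps)
  then have "inner ?r' (?r' - ?r) \<le> 0"
    using step_pos[of "Suc (Suc n)"] by (simp add: mult_le_0_iff)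
  then have "(norm ?r')\<^sup>2 \<le> (norm ?r)\<^sup>2"
    using inner_diff_ge[of ?r' ?r] by linarith
  then show ?thesis
    by (rule power2_le_imp_le) simp
qed

lemma dual_ge:
  assumes "J v \<le> ereal b"
  shows "inner (p (Suc n)) (K v - f) - b \<le> dual (Suc n)"
  using subgradient[OF assms, of n] by (simp add: dual_def res_def inner_diff_right)

text \<open>Minus the residual is a subgradient of the dual functional at \<open>p (Suc n)\<close>:
  test the supremum for \<open>p'\<close> at \<open>u (Suc n)\<close>. A real upper bound
  \<open>D\<close> stands in for that supremum, which could be infinite.\<close>

lemma dual_le:
  assumes "\<And>v b. J v \<le> ereal b \<Longrightarrow> inner p' (K v - f) - b \<le> D"
  shows "dual (Suc n) - inner (p' - p (Suc n)) (res (Suc n)) \<le> D"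
  using assms[of "u (Suc n)" "cost (Suc n)"]
  by (simp add: cost dual_def res_def inner_diff_right inner_diff_left)

lemma dual_decrease:
  "dual (Suc (Suc n)) + \<tau> (Suc (Suc n)) * (norm (res (Suc (Suc n))))\<^sup>2 \<le> dual (Suc n)"
  using dual_le[of "p (Suc n)" "dual (Suc n)" "Suc n", OF dual_ge]
  by (simp add: p_Suc[of "Suc n"] power2_norm_eq_inner)

lemma time_nonneg: "0 \<le> ALM_time \<tau> n"
  unfolding ALM_time_def by (rule sum_nonneg) (simp add: step_pos less_imp_le)

text \<open>The classical estimate for proximal point iterations, weighted by the elapsed time; the
  quadratic residual term is kept because it later yields the decay of the residual.\<close>

lemma proximal_point_estimate:
  assumes D: "\<And>v b. J v \<le> ereal b \<Longrightarrow> inner p' (K v - f) - b \<le> D"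
  shows "ALM_time \<tau> (Suc n) * (dual (Suc n) - D)
      + (ALM_time \<tau> (Suc n))\<^sup>2 / 2 * (norm (res (Suc n)))\<^sup>2 + (norm (p' - p (Suc n)))\<^sup>2 / 2
    \<le> (norm (p' - p0))\<^sup>2 / 2"
proof -
  \<comment> \<open>One proximal step: expand \<open>norm (p' - p n)\<close> around
    \<open>p (Suc n)\<close> and bound the cross term by \<open>dual_le\<close>.\<close>
  have step: "\<tau> (Suc n) * (dual (Suc n) - D) + (\<tau> (Suc n))\<^sup>2 / 2 * (norm (res (Suc n)))\<^sup>2
      + (norm (p' - p (Suc n)))\<^sup>2 / 2 \<le> (norm (p' - p n))\<^sup>2 / 2" for n
  proof -
    let ?r = "res (Suc n)" and ?t = "\<tau> (Suc n)" and ?w = "p' - p (Suc n)"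
    have "?t * (dual (Suc n) - D) \<le> ?t * inner ?w ?r"
      using step_pos[of "Suc n"] dual_le[OF D, of n] by (intro mult_left_mono) auto
    moreover have "(norm (p' - p n))\<^sup>2 = (norm ?w)\<^sup>2 + 2 * (?t * inner ?w ?r) + ?t\<^sup>2 * (norm ?r)\<^sup>2"
    proof -
      have "p' - p n = ?w + ?t *\<^sub>R ?r" by (simp add: p_Suc)
      then show ?thesis
        by (simp only: power2_norm_eq_inner)
          (simp add: inner_add_left inner_add_right inner_commute power2_eq_square algebra_simps)
    qed
    ultimately show ?thesis by simp
  qed
  show ?thesis
  proof (induction n)
    case 0
    then show ?case using step[of 0] by (simp add: p_0)
  next
    case (Suc n)
    let ?t = "ALM_time \<tau> (Suc n)" and ?s = "\<tau> (Suc (Suc n))"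
    let ?R = "(norm (res (Suc n)))\<^sup>2" and ?R' = "(norm (res (Suc (Suc n))))\<^sup>2"
    \<comment> \<open>In the square of \<open>?t + ?s\<close>, the mixed term is paid for by the
      dual decrease, the \<open>?t\<close> term by monotone residuals, and the \<open>?s\<close>
      term by the one-step estimate.\<close>
    have "?t * (dual (Suc (Suc n)) + ?s * ?R') \<le> ?t * dual (Suc n)"
      by (intro mult_left_mono dual_decrease time_nonneg)
    moreover have "?t\<^sup>2 / 2 * ?R' \<le> ?t\<^sup>2 / 2 * ?R"
      by (intro mult_left_mono power_mono norm_res_antimono) auto
    moreover have "(?t + ?s)\<^sup>2 / 2 * ?R' = ?t\<^sup>2 / 2 * ?R' + ?t * ?s * ?R' + ?s\<^sup>2 / 2 * ?R'"
      by (simp add: power2_eq_square field_simps)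
    ultimately show ?case
      using Suc.IH step[of "Suc n"] unfolding ALM_time_Suc[of \<tau> "Suc n"]
      by (simp only: distrib_left distrib_right right_diff_distrib mult.assoc)
  qed
qed

text \<open>The choice \<open>p' = 0\<close>, \<open>D = 0\<close> is admissible because
  \<open>J\<close> is nonnegative. For an exact solution \<open>v\<close> the factor
  \<open>norm (K v - f)\<close> is the noise.\<close>

lemma multiplier_bound:
  assumes "J v \<le> ereal b"
  shows "(norm (p (Suc n)))\<^sup>2 \<le> (norm p0)\<^sup>2
    + 2 * ALM_time \<tau> (Suc n) * (b + norm (K v - f) * norm (p (Suc n)))"
proof -
  have "- b' \<le> 0" if "J w \<le> ereal b'" for w b'
    using order_trans[OF nonneg that] by simp
  then have est: "ALM_time \<tau> (Suc n) * dual (Suc n)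
      + (ALM_time \<tau> (Suc n))\<^sup>2 / 2 * (norm (res (Suc n)))\<^sup>2 + (norm (p (Suc n)))\<^sup>2 / 2
      \<le> (norm p0)\<^sup>2 / 2"
    using proximal_point_estimate[of 0 0 n] by simp
  have "- (norm (p (Suc n)) * norm (K v - f)) \<le> inner (p (Suc n)) (K v - f)"
    using Cauchy_Schwarz_ineq2[of "p (Suc n)" "K v - f"] by linarith
  then have "- (b + norm (K v - f) * norm (p (Suc n))) \<le> dual (Suc n)"
    using dual_ge[OF assms, of n] by (simp add: mult.commute)
  then have "ALM_time \<tau> (Suc n) * - (b + norm (K v - f) * norm (p (Suc n)))
      \<le> ALM_time \<tau> (Suc n) * dual (Suc n)"
    by (intro mult_left_mono time_nonneg)
  moreover have "0 \<le> (ALM_time \<tau> (Suc n))\<^sup>2 / 2 * (norm (res (Suc n)))\<^sup>2" by simp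
  ultimately show ?thesis
    using est by (simp only: mult_minus_right)
qed

text \<open>Divide the proximal point estimate by the elapsed time, after bounding the dual value
  from below by means of \<open>v\<close>. If \<open>p'\<close> is nearly dual optimal,
  \<open>D + b\<close> is small.\<close>

lemma residual_bound:
  assumes v: "J v \<le> ereal b"
    and D: "\<And>v b. J v \<le> ereal b \<Longrightarrow> inner p' (K v - f) - b \<le> D"
    and t: "0 < ALM_time \<tau> (Suc n)"
  shows "ALM_time \<tau> (Suc n) * (norm (res (Suc n)))\<^sup>2
    \<le> 2 * (D + b + norm (K v - f) * norm (p (Suc n))) + (norm (p' - p0))\<^sup>2 / ALM_time \<tau> (Suc n)"
proof -
  let ?t = "ALM_time \<tau> (Suc n)" and ?R = "(norm (res (Suc n)))\<^sup>2"
  have "- (norm (p (Suc n)) * norm (K v - f)) \<le> inner (p (Suc n)) (K v - f)"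
    using Cauchy_Schwarz_ineq2[of "p (Suc n)" "K v - f"] by linarith
  then have "- (b + norm (K v - f) * norm (p (Suc n))) \<le> dual (Suc n)"
    using dual_ge[OF v, of n] by (simp add: mult.commute)
  then have "?t * (- (b + norm (K v - f) * norm (p (Suc n))) - D) \<le> ?t * (dual (Suc n) - D)"
    using t by (intro mult_left_mono) auto
  moreover have "?t * (dual (Suc n) - D) + ?t\<^sup>2 / 2 * ?R \<le> (norm (p' - p0))\<^sup>2 / 2"
    using proximal_point_estimate[OF D, of n] zero_le_power2[of "norm (p' - p (Suc n))"] by linarith
  ultimately have "?t * (?t * ?R)
      \<le> ?t * (2 * (D + b + norm (K v - f) * norm (p (Suc n)))) + (norm (p' - p0))\<^sup>2"
    by (simp add: power2_eq_square distrib_left right_diff_distrib del: ALM_time_Suc)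
  then show ?thesis
    using t by (simp add: field_simps del: ALM_time_Suc)
qed

text \<open>Both pairings with the multiplier are estimated by Cauchy-Schwarz; convergence then
  reduces to the two products of norms tending to 0.\<close>

lemma cost_bound:
  assumes "J v \<le> ereal b"
  shows "cost (Suc n) \<le> b + norm (K v - f) * norm (p (Suc n)) + norm (p (Suc n)) * norm (res (Suc n))"
proof -
  have "- (norm (p (Suc n)) * norm (K v - f)) \<le> inner (p (Suc n)) (K v - f)"
    "- (norm (p (Suc n)) * norm (res (Suc n))) \<le> inner (p (Suc n)) (res (Suc n))"
    using Cauchy_Schwarz_ineq2[of "p (Suc n)" "K v - f"]
      Cauchy_Schwarz_ineq2[of "p (Suc n)" "res (Suc n)"] by linarith+
  then show ?thesis
    using dual_ge[OF assms, of n] by (simp add: dual_def algebra_simps)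
qed

end

text \<open>Young's inequality absorbs half of \<open>P\<^sup>2\<close>; the remaining
  \<open>2 * t\<^sup>2 * \<delta>\<^sup>2\<close> is at most \<open>2 * t\<close>.\<close>

lemma sq_le_of_quadratic_bound:
  fixes P p0 t b \<delta> :: real
  assumes bd: "P\<^sup>2 \<le> p0 + 2 * t * (b + \<delta> * P)" and "1 \<le> t" "\<delta>\<^sup>2 * t \<le> 1" "0 \<le> p0"
  shows "P\<^sup>2 \<le> (2 * p0 + 4 * b + 4) * t"
proof -
  have "0 \<le> (P - 2 * (t * \<delta>))\<^sup>2" by simp
  then have "4 * (t * (\<delta> * P)) \<le> P\<^sup>2 + 4 * (t * (\<delta>\<^sup>2 * t))"
    by (simp add: power2_eq_square algebra_simps)
  moreover have "t * (\<delta>\<^sup>2 * t) \<le> t * 1"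
    using assms by (intro mult_left_mono) auto
  moreover have "p0 * 1 \<le> p0 * t"
    using assms by (intro mult_left_mono) auto
  ultimately show ?thesis
    using bd by (simp add: algebra_simps)
qed

text \<open>The dual value of the multiplier \<open>p'\<close> is within \<open>e\<close> of the optimal value \<open>b\<close> of
  \<^emph>\<open>minimize J subject to K w = g\<close>.\<close>

definition almost_dual_optimal ::
    "('a \<Rightarrow> 'b::real_inner) \<Rightarrow> ('a \<Rightarrow> ereal) \<Rightarrow> 'b \<Rightarrow> real \<Rightarrow> real \<Rightarrow> 'b \<Rightarrow> bool"
  where "almost_dual_optimal K J g b e p' \<longleftrightarrow>
    (\<forall>w c. J w \<le> ereal c \<longrightarrow> inner p' (K w - g) - c \<le> - b + e)"

section \<open>Exact data: existence of almost optimal multipliers\<close>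

context ALM
begin

text \<open>With exact data the multipliers themselves become almost dual optimal: if the pairing of
  multiplier and residual stayed below a negative constant, the norm of the multiplier would
  decrease without bound.\<close>

lemma ex_almost_dual_optimal:
  assumes time: "filterlim (ALM_time \<tau>) at_top sequentially"
    and v: "K v = f" "J v \<le> ereal b"
    and lsc: "\<And>x e. (\<lambda>n. K (x n)) \<longlonglongrightarrow> f \<Longrightarrow> 0 < e \<Longrightarrow> \<forall>\<^sub>F n in sequentially. \<not> J (x n) \<le> ereal (b - e)"
    and "0 < e"
  shows "\<exists>p'. almost_dual_optimal K J f b e p'"
proof -
  let ?t = "\<lambda>n. ALM_time \<tau> (Suc n)"
  have time_Suc: "filterlim ?t at_top sequentially"
    using filterlim_compose[OF time filterlim_Suc] .
  \<comment> \<open>Apply \<open>residual_bound\<close> with \<open>p' = 0\<close>,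
    \<open>D = 0\<close>; exactness \<open>K v = f\<close> removes the term containing the
    multiplier.\<close>
  have "(\<lambda>n. norm (res (Suc n))) \<longlonglongrightarrow> 0"
  proof (rule tendsto_zero_if_square_le)
    show "(\<lambda>n. 2 * b / ?t n + (norm p0)\<^sup>2 / ?t n / ?t n) \<longlonglongrightarrow> 0"
    proof -
      have lim0: "(\<lambda>n. c / ?t n) \<longlonglongrightarrow> 0" for c
        by (rule real_tendsto_divide_at_top[OF tendsto_const time_Suc])
      show ?thesis
        using tendsto_add_zero[OF lim0[of "2 * b"]
            real_tendsto_divide_at_top[OF lim0[of "(norm p0)\<^sup>2"] time_Suc]] .
    qed
    have "\<forall>\<^sub>F n in sequentially. 0 < ?t n"
      using time_Suc by (simp add: filterlim_at_top_dense)
    then show "\<forall>\<^sub>F n in sequentially. (norm (res (Suc n)))\<^sup>2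
        \<le> 2 * b / ?t n + (norm p0)\<^sup>2 / ?t n / ?t n"
    proof eventually_elim
      case (elim n)
      have "- c \<le> 0" if "J w \<le> ereal c" for w c
        using order_trans[OF nonneg that] by simp
      then have "?t n * (norm (res (Suc n)))\<^sup>2 \<le> 2 * b + (norm p0)\<^sup>2 / ?t n"
        using residual_bound[OF v(2) _ elim, of 0 0] v(1) by simp
      then have "(norm (res (Suc n)))\<^sup>2 \<le> (2 * b + (norm p0)\<^sup>2 / ?t n) / ?t n"
        using elim by (simp add: pos_le_divide_eq mult.commute del: ALM_time_Suc)
      then show ?case
        by (simp only: add_divide_distrib)
    qed
  qed
  then have "(\<lambda>n. f - res (Suc n)) \<longlonglongrightarrow> f - 0"
    by (intro tendsto_diff tendsto_const) (rule tendsto_norm_zero_cancel)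
  then have "(\<lambda>n. K (u (Suc n))) \<longlonglongrightarrow> f"
    by (simp add: res_def)
  \<comment> \<open>Half of \<open>e\<close> is spent on the cost and half on the pairing with the
    residual; together they bound \<open>dual\<close>.\<close>
  from lsc[OF this, of "e / 2"] \<open>0 < e\<close>
  have "\<forall>\<^sub>F n in sequentially. b - e / 2 < cost (Suc n)"
    by (simp add: cost not_le)
  then obtain N where N: "\<And>n. N \<le> n \<Longrightarrow> b - e / 2 < cost (Suc n)"
    by (auto simp: eventually_sequentially)
  have "\<exists>n\<ge>N. - (e / 2) \<le> inner (p (Suc n)) (res (Suc n))"
  proof (rule ccontr)
    assume contra: "\<not> ?thesis"
    have neg: "inner (p (Suc n)) (res (Suc n)) < - (e / 2)" if "N \<le> n" for n
    proof (rule ccontr)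
      assume "\<not> ?thesis"
      then have "- (e / 2) \<le> inner (p (Suc n)) (res (Suc n))" by simp
      with contra that show False by blast
    qed
    have decr: "(norm (p n))\<^sup>2 \<le> (norm (p N))\<^sup>2 - e * (ALM_time \<tau> n - ALM_time \<tau> N)" if "N \<le> n" for n
      using that
    proof (induction n rule: dec_induct)
      case (step n)
      have "(norm (p (Suc n)))\<^sup>2 - (norm (p n))\<^sup>2 \<le> 2 * (\<tau> (Suc n) * inner (p (Suc n)) (res (Suc n)))"
        using inner_diff_ge[of "p (Suc n)" "p n"] by (simp add: p_Suc)
      moreover have "\<tau> (Suc n) * inner (p (Suc n)) (res (Suc n)) \<le> \<tau> (Suc n) * - (e / 2)"
        using neg[OF step.hyps(1)] step_pos[of "Suc n"] by (intro mult_left_mono) auto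
      ultimately show ?case
        using step.IH by (simp add: algebra_simps)
    qed simp
    obtain n where n: "N \<le> n" "ALM_time \<tau> N + (norm (p N))\<^sup>2 / e < ALM_time \<tau> n"
    proof -
      have "\<forall>\<^sub>F n in sequentially. ALM_time \<tau> N + (norm (p N))\<^sup>2 / e < ALM_time \<tau> n"
        using time by (simp add: filterlim_at_top_dense)
      then have "\<forall>\<^sub>F n in sequentially. N \<le> n \<and> ALM_time \<tau> N + (norm (p N))\<^sup>2 / e < ALM_time \<tau> n"
        using eventually_ge_at_top[of N] by (rule eventually_elim2) simp
      then show ?thesis
        using that eventually_happens'[OF sequentially_bot] by blast
    qed
    from n(2) have "(norm (p N))\<^sup>2 < e * (ALM_time \<tau> n - ALM_time \<tau> N)"
      using \<open>0 < e\<close> by (simp add: field_simps)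
    with decr[OF n(1)] show False
      using zero_le_power2[of "norm (p n)"] by linarith
  qed
  then obtain n where n: "N \<le> n" "- (e / 2) \<le> inner (p (Suc n)) (res (Suc n))" by blast
  then have "dual (Suc n) \<le> - b + e"
    using N[OF n(1)] by (simp add: dual_def)
  then have "almost_dual_optimal K J f b e (p (Suc n))"
    unfolding almost_dual_optimal_def using dual_ge[of _ _ n] by force
  then show ?thesis ..
qed

end

text \<open>Each \<open>k\<close> has its own data and run, stopped at \<open>n k\<close>. The
  bounds \<open>P\<^sup>2 \<le> C * T\<close>, \<open>\<delta>\<^sup>2 * T \<rightarrow> 0\<close>
  and \<open>T * \<rho>\<^sup>2 \<rightarrow> 0\<close> make both error products in
  \<open>cost_bound\<close> vanish.\<close>

lemma ALM_regularization_asymptotics: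
  fixes K :: "'a::real_vector \<Rightarrow> 'b::real_inner" and u :: "nat \<Rightarrow> nat \<Rightarrow> 'a" and n :: "nat \<Rightarrow> nat"
  assumes alm: "\<And>k. ALM K J \<tau> p0 (f k) (u k) (p k)"
    and \<delta>0: "\<delta> \<longlonglongrightarrow> 0" and noise: "\<And>k. norm (f k - g) \<le> \<delta> k"
    and time: "filterlim (\<lambda>k. ALM_time \<tau> (n k)) at_top sequentially"
    and \<delta>t: "(\<lambda>k. (\<delta> k)\<^sup>2 * ALM_time \<tau> (n k)) \<longlonglongrightarrow> 0"
    and v: "K v = g" "J v \<le> ereal b"
    and dual: "\<And>e. 0 < e \<Longrightarrow> \<exists>p'. almost_dual_optimal K J g b e p'"
  shows "(\<lambda>k. K (u k (n k))) \<longlonglongrightarrow> g"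
    and "\<And>e. 0 < e \<Longrightarrow> \<forall>\<^sub>F k in sequentially. J (u k (n k)) \<le> ereal (b + e)"
proof -
  define T where "T k = ALM_time \<tau> (n k)" for k
  define P where "P k = norm (p k (n k))" for k
  define \<rho> where "\<rho> k = norm (f k - K (u k (n k)))" for k
  define C where "C = 2 * (norm p0)\<^sup>2 + 4 * b + 4"
  note time = time[folded T_def] and \<delta>t = \<delta>t[folded T_def]
  have \<delta>_nonneg: "0 \<le> \<delta> k" for k
    using order_trans[OF norm_ge_zero noise] .
  have P_nonneg: "0 \<le> P k" and \<rho>_nonneg: "0 \<le> \<rho> k" for k
    by (simp_all add: P_def \<rho>_def)
  have T_ge_1: "\<forall>\<^sub>F k in sequentially. 1 \<le> T k"
    using time by (simp add: filterlim_at_top)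
  \<comment> \<open>Positive time excludes the stopping index 0, where the primal iterate is
    arbitrary.\<close>
  have Suc: "\<exists>m. n k = Suc m" if "1 \<le> T k" for k
    using that by (cases "n k") (auto simp: T_def)
  have noise': "norm (K v - f k) * P k \<le> \<delta> k * P k" for k
    using noise[of k] v(1) by (intro mult_right_mono P_nonneg) (simp add: norm_minus_commute)

  have "\<forall>\<^sub>F k in sequentially. (\<delta> k)\<^sup>2 * T k < 1"
    using order_tendstoD(2)[OF \<delta>t, of 1] by simp
  with T_ge_1 have P_le: "\<forall>\<^sub>F k in sequentially. (P k)\<^sup>2 \<le> C * T k"
  proof eventually_elim
    case (elim k)
    obtain m where m: "n k = Suc m" using Suc elim by blast
    interpret ALM K J \<tau> p0 "f k" "u k" "p k" by (rule alm)
    have "(P k)\<^sup>2 \<le> (norm p0)\<^sup>2 + 2 * T k * (b + norm (K v - f k) * P k)"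
      using multiplier_bound[OF v(2), of m] by (simp only: T_def P_def m)
    also have "\<dots> \<le> (norm p0)\<^sup>2 + 2 * T k * (b + \<delta> k * P k)"
      using elim noise'[of k] by (intro add_left_mono mult_left_mono) auto
    finally show ?case
      unfolding C_def using elim by (intro sq_le_of_quadratic_bound) auto
  qed

  have \<delta>P: "(\<lambda>k. \<delta> k * P k) \<longlonglongrightarrow> 0"
  proof (rule tendsto_zero_if_square_le)
    show "\<forall>\<^sub>F k in sequentially. (\<delta> k * P k)\<^sup>2 \<le> C * ((\<delta> k)\<^sup>2 * T k)"
      using P_le
    proof eventually_elim
      case (elim k)
      then have "(\<delta> k)\<^sup>2 * (P k)\<^sup>2 \<le> (\<delta> k)\<^sup>2 * (C * T k)"
        by (intro mult_left_mono) auto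
      then show ?case by (simp add: power_mult_distrib algebra_simps)
    qed
    show "(\<lambda>k. C * ((\<delta> k)\<^sup>2 * T k)) \<longlonglongrightarrow> 0"
      using tendsto_mult_right_zero[OF \<delta>t] .
  qed

  have T\<rho>: "(\<lambda>k. T k * (\<rho> k)\<^sup>2) \<longlonglongrightarrow> 0"
  proof (rule order_tendstoI)
    fix a :: real
    assume "a < 0"
    show "\<forall>\<^sub>F k in sequentially. a < T k * (\<rho> k)\<^sup>2"
      using T_ge_1
    proof eventually_elim
      case (elim k)
      then have "0 \<le> T k * (\<rho> k)\<^sup>2" by simp
      with \<open>a < 0\<close> show ?case by linarith
    qed
  next
    fix a :: real
    assume "0 < a"
    then obtain p' where p': "almost_dual_optimal K J g b (a / 4) p'"
      using dual[of "a / 4"] by auto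
    \<comment> \<open>The tolerance \<open>a / 4\<close> of \<open>p'\<close> enters doubled, so
      this limit is \<open>a / 2\<close>, below \<open>a\<close>.\<close>
    have "(\<lambda>k. 2 * (a / 4 + norm p' * \<delta> k + \<delta> k * P k) + (norm (p' - p0))\<^sup>2 / T k) \<longlonglongrightarrow>
        2 * (a / 4 + norm p' * 0 + 0) + 0"
      by (intro tendsto_intros \<delta>0 \<delta>P real_tendsto_divide_at_top[OF tendsto_const time])
    from order_tendstoD(2)[OF this, of a] \<open>0 < a\<close>
    have "\<forall>\<^sub>F k in sequentially.
        2 * (a / 4 + norm p' * \<delta> k + \<delta> k * P k) + (norm (p' - p0))\<^sup>2 / T k < a"
      by simp
    with T_ge_1 show "\<forall>\<^sub>F k in sequentially. T k * (\<rho> k)\<^sup>2 < a"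
    proof eventually_elim
      case (elim k)
      obtain m where m: "n k = Suc m" using Suc elim by blast
      interpret ALM K J \<tau> p0 "f k" "u k" "p k" by (rule alm)
      \<comment> \<open>Replacing \<open>g\<close> by the noisy data shifts the dual value of the
        fixed \<open>p'\<close> by at most \<open>norm p' * \<delta> k\<close>.\<close>
      have D: "inner p' (K w - f k) - c \<le> - b + a / 4 + norm p' * \<delta> k" if "J w \<le> ereal c" for w c
      proof -
        have "inner p' (g - f k) \<le> norm p' * norm (g - f k)"
          by (rule norm_cauchy_schwarz)
        also have "\<dots> \<le> norm p' * \<delta> k"
          using noise[of k] by (intro mult_left_mono) (auto simp: norm_minus_commute)
        finally have "inner p' (g - f k) \<le> norm p' * \<delta> k" .
        moreover have "inner p' (K w - f k) = inner p' (K w - g) + inner p' (g - f k)"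
          by (simp add: inner_diff_right)
        ultimately show ?thesis
          using p' that unfolding almost_dual_optimal_def by force
      qed
      have "T k * (\<rho> k)\<^sup>2 \<le> 2 * (- b + a / 4 + norm p' * \<delta> k + b + norm (K v - f k) * P k)
          + (norm (p' - p0))\<^sup>2 / T k"
        using residual_bound[OF v(2) D, of m] elim(1)
        unfolding T_def P_def m \<rho>_def res_def by (simp del: ALM_time_Suc)
      then show ?case
        using noise'[of k] elim(2) by (simp add: algebra_simps)
    qed
  qed

  have P\<rho>: "(\<lambda>k. P k * \<rho> k) \<longlonglongrightarrow> 0"
  proof (rule tendsto_zero_if_square_le)
    show "\<forall>\<^sub>F k in sequentially. (P k * \<rho> k)\<^sup>2 \<le> C * (T k * (\<rho> k)\<^sup>2)"
      using P_le
    proof eventually_elim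
      case (elim k)
      then have "(P k)\<^sup>2 * (\<rho> k)\<^sup>2 \<le> C * T k * (\<rho> k)\<^sup>2"
        by (intro mult_right_mono) auto
      then show ?case by (simp add: power_mult_distrib algebra_simps)
    qed
    show "(\<lambda>k. C * (T k * (\<rho> k)\<^sup>2)) \<longlonglongrightarrow> 0"
      using tendsto_mult_right_zero[OF T\<rho>] .
  qed

  have "\<rho> \<longlonglongrightarrow> 0"
  proof (rule tendsto_zero_if_square_le[OF _ T\<rho>])
    show "\<forall>\<^sub>F k in sequentially. (\<rho> k)\<^sup>2 \<le> T k * (\<rho> k)\<^sup>2"
      using T_ge_1 by eventually_elim (use mult_right_mono[of 1 _ "(\<rho> _)\<^sup>2"] in auto)
  qed
  then have "(\<lambda>k. f k - K (u k (n k))) \<longlonglongrightarrow> 0"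
    unfolding \<rho>_def by (rule tendsto_norm_zero_cancel)
  moreover have "(\<lambda>k. f k - g) \<longlonglongrightarrow> 0"
    by (rule Lim_null_comparison[OF _ \<delta>0]) (simp add: noise)
  ultimately have "(\<lambda>k. (f k - g) - (f k - K (u k (n k)))) \<longlonglongrightarrow> 0 - 0"
    by (intro tendsto_diff)
  then show "(\<lambda>k. K (u k (n k))) \<longlonglongrightarrow> g"
    by (simp add: LIM_zero_iff)

  fix e :: real
  assume "0 < e"
  have "(\<lambda>k. \<delta> k * P k + P k * \<rho> k) \<longlonglongrightarrow> 0"
    using tendsto_add[OF \<delta>P P\<rho>] by simp
  from order_tendstoD(2)[OF this \<open>0 < e\<close>] T_ge_1
  show "\<forall>\<^sub>F k in sequentially. J (u k (n k)) \<le> ereal (b + e)"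
  proof eventually_elim
    case (elim k)
    obtain m where m: "n k = Suc m" using Suc elim by blast
    interpret ALM K J \<tau> p0 "f k" "u k" "p k" by (rule alm)
    have "cost (n k) \<le> b + norm (K v - f k) * P k + P k * \<rho> k"
      using cost_bound[OF v(2), of m] by (simp only: P_def m \<rho>_def res_def)
    then have "cost (n k) \<le> b + e"
      using elim noise'[of k] by linarith
    then show ?case
      by (simp add: m cost)
  qed
qed

section \<open>Weak sequential compactness in the sequence space\<close>

lift_definition ell2_unit :: "nat \<Rightarrow> ell2" is "\<lambda>k j. if j = k then 1 else 0"
  by (rule summable_finite[of "{_}"]) auto

text \<open>Written as a combination of unit vectors so that linear maps apply termwise.\<close>

definition ell2_trunc :: "nat \<Rightarrow> ell2 \<Rightarrow> ell2"
  where "ell2_trunc N a = (\<Sum>k<N. ell2_nth a k *\<^sub>R ell2_unit k)"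

lemma inner_ell2_unit: "inner (ell2_unit k) v = ell2_nth v k"
  by transfer (subst suminf_finite[of "{_}"]; auto)

lemma inner_ell2_trunc: "inner (ell2_trunc N a) v = (\<Sum>k<N. ell2_nth a k * ell2_nth v k)"
  by (simp add: ell2_trunc_def inner_sum_left inner_ell2_unit)

lemma ell2_nth_trunc: "ell2_nth (ell2_trunc N a) k = (if k < N then ell2_nth a k else 0)"
proof -
  have "ell2_nth (ell2_trunc N a) k = inner (ell2_trunc N a) (ell2_unit k)"
    by (simp add: inner_ell2_unit inner_commute)
  also have "\<dots> = (\<Sum>j<N. if k = j then ell2_nth a j else 0)"
    unfolding inner_ell2_trunc ell2_unit.rep_eq by (rule sum.cong) auto
  finally show ?thesis by simp
qed

lemma norm_ell2_trunc: "(norm (ell2_trunc N a))\<^sup>2 = (\<Sum>k<N. (ell2_nth a k)\<^sup>2)"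
  unfolding power2_norm_eq_inner inner_ell2_trunc
  by (rule sum.cong) (simp_all add: ell2_nth_trunc power2_eq_square)

text \<open>By Pythagoras the squared error is the tail of the series for
  \<open>norm a\<close>.\<close>

lemma ell2_trunc_tendsto: "(\<lambda>N. ell2_trunc N a) \<longlonglongrightarrow> a"
proof -
  have "(norm (a - ell2_trunc N a))\<^sup>2 = (norm a)\<^sup>2 - (\<Sum>k<N. (ell2_nth a k)\<^sup>2)" for N
  proof -
    have "inner (ell2_trunc N a) a = (\<Sum>k<N. (ell2_nth a k)\<^sup>2)"
      by (simp add: inner_ell2_trunc power2_eq_square)
    then show ?thesis
      using norm_ell2_trunc[of N a]
      by (simp add: power2_norm_eq_inner inner_diff_left inner_diff_right inner_commute)
  qed
  moreover have "(\<lambda>N. (norm a)\<^sup>2 - (\<Sum>k<N. (ell2_nth a k)\<^sup>2)) \<longlonglongrightarrow> 0"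
    using tendsto_diff[OF tendsto_const[of "(norm a)\<^sup>2"] summable_LIMSEQ[OF summable_ell2_nth_square[of a]]]
    by (simp add: norm_ell2_square)
  ultimately have "(\<lambda>N. norm (a - ell2_trunc N a)) \<longlonglongrightarrow> 0"
    using tendsto_zero_if_square_le[of "\<lambda>N. norm (a - ell2_trunc N a)"
        "\<lambda>N. (norm a)\<^sup>2 - (\<Sum>k<N. (ell2_nth a k)\<^sup>2)" sequentially] by simp
  then have "(\<lambda>N. a - (a - ell2_trunc N a)) \<longlonglongrightarrow> a - 0"
    by (intro tendsto_diff tendsto_const) (rule tendsto_norm_zero_cancel)
  then show ?thesis by simp
qed

text \<open>The representing coefficients are the values of \<open>\<phi>\<close> on unit vectors.
  Testing \<open>\<phi>\<close> on the finite combination with these same coefficients bounds their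
  square sums; density of the truncations extends the formula to all vectors.\<close>

lemma ell2_riesz:
  assumes "bounded_linear (\<phi> :: ell2 \<Rightarrow> real)"
  obtains a where "\<And>v. \<phi> v = inner a v"
proof -
  interpret \<phi>: bounded_linear \<phi> by fact
  obtain B where B: "0 < B" "\<And>v. norm (\<phi> v) \<le> norm v * B"
    using \<phi>.pos_bounded by blast
  define \<alpha> where "\<alpha> k = \<phi> (ell2_unit k)" for k
  have trunc: "\<phi> (\<Sum>k<N. c k *\<^sub>R ell2_unit k) = (\<Sum>k<N. c k * \<alpha> k)" for N c
    by (simp add: \<phi>.sum \<phi>.scaleR \<alpha>_def)
  have "(\<Sum>k<N. (\<alpha> k)\<^sup>2) \<le> B\<^sup>2" for N
  proof -
    let ?S = "\<Sum>k<N. (\<alpha> k)\<^sup>2" and ?w = "\<Sum>k<N. \<alpha> k *\<^sub>R ell2_unit k"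
    have "(norm ?w)\<^sup>2 = ?S"
    proof -
      have "ell2_nth ?w j = (if j < N then \<alpha> j else 0)" for j
      proof -
        have "ell2_nth ?w j = (\<Sum>k<N. if j = k then \<alpha> k else 0)"
          unfolding inner_ell2_unit[symmetric] inner_sum_right inner_scaleR_right
          unfolding inner_ell2_unit ell2_unit.rep_eq by (rule sum.cong) auto
        then show ?thesis by simp
      qed
      then show ?thesis
        by (simp only: power2_norm_eq_inner)
          (simp add: inner_sum_left inner_ell2_unit power2_eq_square)
    qed
    moreover have "?S \<le> norm ?w * B"
      using B(2)[of ?w] by (simp add: trunc power2_eq_square)
    ultimately have "norm ?w * norm ?w \<le> norm ?w * B"
      by (simp add: power2_eq_square)
    then have "norm ?w \<le> B"
      using B(1) by (cases "norm ?w = 0") auto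
    then show ?thesis
      using power_mono[of "norm ?w" B 2] \<open>(norm ?w)\<^sup>2 = ?S\<close> by simp
  qed
  then have "summable (\<lambda>k. (\<alpha> k)\<^sup>2)"
    by (intro summableI_nonneg_bounded) auto
  then have nth: "ell2_nth (Abs_ell2 \<alpha>) = \<alpha>"
    by (simp add: Abs_ell2_inverse)
  have "\<phi> v = inner (Abs_ell2 \<alpha>) v" for v
  proof (rule LIMSEQ_unique)
    show "(\<lambda>N. \<phi> (ell2_trunc N v)) \<longlonglongrightarrow> \<phi> v"
      by (intro \<phi>.tendsto ell2_trunc_tendsto)
    have "\<phi> (ell2_trunc N v) = inner (Abs_ell2 \<alpha>) (ell2_trunc N v)" for N
      unfolding inner_commute[of "Abs_ell2 \<alpha>"] inner_ell2_trunc
      by (simp add: ell2_trunc_def trunc nth)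
    then show "(\<lambda>N. \<phi> (ell2_trunc N v)) \<longlonglongrightarrow> inner (Abs_ell2 \<alpha>) v"
      by (simp add: tendsto_inner ell2_trunc_tendsto)
  qed
  then show ?thesis by (rule that)
qed

text \<open>Represent \<open>\<phi>\<close> by a vector and truncate it: finitely many coordinates
  converge, and the remainder is uniformly small on bounded sequences.\<close>

lemma ell2_weakly_convergent:
  assumes \<phi>: "bounded_linear (\<phi> :: ell2 \<Rightarrow> real)"
    and conv: "\<And>k. (\<lambda>n. ell2_nth (x n) k) \<longlonglongrightarrow> ell2_nth u k"
    and bound: "\<And>n. norm (x n) \<le> B"
  shows "(\<lambda>n. \<phi> (x n)) \<longlonglongrightarrow> \<phi> u"
proof -
  obtain a where a: "\<And>v. \<phi> v = inner a v"
    using ell2_riesz[OF \<phi>] by blast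
  have "(\<lambda>n. inner a (x n - u)) \<longlonglongrightarrow> 0"
  proof (rule LIMSEQ_I)
    fix e :: real
    assume "0 < e"
    define M where "M = B + norm u + 1"
    have "0 < M"
      using order_trans[OF norm_ge_zero bound[of 0]] norm_ge_zero[of u] unfolding M_def by linarith
    have M: "norm (x n - u) \<le> M" for n
      using bound[of n] norm_triangle_ineq4[of "x n" u] unfolding M_def by linarith
    obtain N where N: "norm (ell2_trunc N a - a) < e / (2 * M)"
      using LIMSEQ_D[OF ell2_trunc_tendsto[of a], of "e / (2 * M)"] \<open>0 < e\<close> \<open>0 < M\<close> by auto
    have "(\<lambda>n. inner (ell2_trunc N a) (x n - u)) \<longlonglongrightarrow> (\<Sum>k<N. ell2_nth a k * (ell2_nth u k - ell2_nth u k))"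
      unfolding inner_ell2_trunc minus_ell2.rep_eq by (intro tendsto_intros conv)
    from LIMSEQ_D[OF this, of "e / 2"] \<open>0 < e\<close>
    obtain n0 where n0: "\<And>n. n0 \<le> n \<Longrightarrow> \<bar>inner (ell2_trunc N a) (x n - u)\<bar> < e / 2"
      by auto
    have "norm (inner a (x n - u) - 0) < e" if "n0 \<le> n" for n
    proof -
      have "\<bar>inner (ell2_trunc N a - a) (x n - u)\<bar> \<le> norm (ell2_trunc N a - a) * norm (x n - u)"
        by (rule Cauchy_Schwarz_ineq2)
      also have "\<dots> \<le> e / (2 * M) * M"
        using N M[of n] \<open>0 < M\<close> \<open>0 < e\<close> by (intro mult_mono) auto
      also have "\<dots> = e / 2"
        using \<open>0 < M\<close> by simp
      finally have "\<bar>inner (ell2_trunc N a) (x n - u) - inner a (x n - u)\<bar> \<le> e / 2"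
        by (simp only: inner_diff_left)
      then show ?thesis
        using n0[OF that] unfolding real_norm_def diff_0_right by linarith
    qed
    then show "\<exists>n0. \<forall>n\<ge>n0. norm (inner a (x n - u) - 0) < e" by blast
  qed
  then show ?thesis
    by (simp add: a inner_diff_right LIM_zero_iff)
qed

text \<open>Tychonoff replaces the diagonal argument: the box is compact, and a countable index type
  makes the product topology first countable, so compactness is sequential.\<close>

lemma bounded_componentwise_convergent_subsequence:
  fixes x :: "nat \<Rightarrow> 'i::countable \<Rightarrow> real"
  assumes "\<And>n k. \<bar>x n k\<bar> \<le> B"
  obtains r l where "strict_mono (r :: nat \<Rightarrow> nat)" "\<And>k. (\<lambda>n. x (r n) k) \<longlonglongrightarrow> l k"
proof -
  let ?S = "PiE UNIV (\<lambda>_::'i. {-B..B})"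
  have "compactin (product_topology (\<lambda>_::'i. euclidean :: real topology) UNIV) ?S"
    unfolding compactin_PiE by simp
  then have "compact ?S"
    by (simp add: euclidean_product_topology)
  then have "seq_compact ?S"
    by (rule compact_imp_seq_compact)
  moreover have "x n \<in> ?S" for n
    using assms[of n] by (auto simp: abs_le_iff minus_le_iff)
  ultimately obtain l r where "strict_mono (r :: nat \<Rightarrow> nat)" and r: "(x \<circ> r) \<longlonglongrightarrow> l"
    unfolding seq_compact_def by metis
  have "(\<lambda>n. x (r n) k) \<longlonglongrightarrow> l k" for k
    using continuous_on_tendsto_compose[OF continuous_on_product_coordinates r, of k] by (simp add: o_def)
  with \<open>strict_mono r\<close> show ?thesis by (rule that)
qed

text \<open>The bound on finite square sums survives the limit, so the componentwise limit is square
  summable.\<close>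

lemma ell2_componentwise_convergent_subsequence:
  assumes "\<And>n. norm (x n :: ell2) \<le> B"
  obtains r u where "strict_mono (r :: nat \<Rightarrow> nat)"
    "\<And>k. (\<lambda>n. ell2_nth (x (r n)) k) \<longlonglongrightarrow> ell2_nth u k"
proof -
  have "\<bar>ell2_nth (x n) k\<bar> \<le> B" for n k
    using order_trans[OF abs_ell2_nth_le assms] .
  then obtain r l where r: "strict_mono (r :: nat \<Rightarrow> nat)" "\<And>k. (\<lambda>n. ell2_nth (x (r n)) k) \<longlonglongrightarrow> l k"
    using bounded_componentwise_convergent_subsequence[of "\<lambda>n. ell2_nth (x n)" B] by blast
  have "(\<Sum>k<N. (l k)\<^sup>2) \<le> B\<^sup>2" for N
  proof (rule LIMSEQ_le_const2)
    show "(\<lambda>n. \<Sum>k<N. (ell2_nth (x (r n)) k)\<^sup>2) \<longlonglongrightarrow> (\<Sum>k<N. (l k)\<^sup>2)"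
      by (intro tendsto_intros r)
    show "\<exists>n0. \<forall>n\<ge>n0. (\<Sum>k<N. (ell2_nth (x (r n)) k)\<^sup>2) \<le> B\<^sup>2"
      using order_trans[OF sum_ell2_nth_le power_mono[OF assms norm_ge_zero]] by blast
  qed
  then have "summable (\<lambda>k. (l k)\<^sup>2)"
    by (intro summableI_nonneg_bounded) auto
  then show ?thesis
    using that[of r "Abs_ell2 l"] r by (simp add: Abs_ell2_inverse)
qed

section \<open>The \<open>q\<close>-norm penalty\<close>

text \<open>Finite partial sums suit both convexity and componentwise limits, and no case split on
  summability remains.\<close>

lemma lq_functional_le_iff:
  "lq_functional q u \<le> ereal c \<longleftrightarrow> (\<forall>N. (\<Sum>k<N. \<bar>ell2_nth u k\<bar> powr q) \<le> c)"
proof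
  assume L: "lq_functional q u \<le> ereal c"
  then have s: "summable (\<lambda>k. \<bar>ell2_nth u k\<bar> powr q)" and c: "(\<Sum>k. \<bar>ell2_nth u k\<bar> powr q) \<le> c"
    by (auto simp: lq_functional_def split: if_splits)
  show "\<forall>N. (\<Sum>k<N. \<bar>ell2_nth u k\<bar> powr q) \<le> c"
    using order_trans[OF sum_le_suminf[OF s] c] by simp
next
  assume B: "\<forall>N. (\<Sum>k<N. \<bar>ell2_nth u k\<bar> powr q) \<le> c"
  then have "summable (\<lambda>k. \<bar>ell2_nth u k\<bar> powr q)"
    by (intro summableI_nonneg_bounded) auto
  then show "lq_functional q u \<le> ereal c"
    using B by (simp add: lq_functional_def suminf_le_const)
qed

lemma lq_functional_nonneg: "0 \<le> lq_functional q u"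
  by (auto simp: lq_functional_def intro!: suminf_nonneg)

lemma abs_powr_convex:
  fixes x y :: real
  assumes q: "1 \<le> q" and s: "0 \<le> s" "s \<le> 1"
  shows "\<bar>(1 - s) * x + s * y\<bar> powr q \<le> (1 - s) * \<bar>x\<bar> powr q + s * \<bar>y\<bar> powr q"
proof -
  have le: "(t * a) powr q \<le> t * a powr q" if "0 \<le> t" "t \<le> 1" "0 \<le> a" for t a :: real
  proof -
    have "t powr q \<le> t"
      using powr_mono'[of 1 q t] that q by simp
    then show ?thesis
      using that by (simp add: powr_mult mult_right_mono)
  qed
  have "\<bar>(1 - s) * x + s * y\<bar> \<le> (1 - s) * \<bar>x\<bar> + s * \<bar>y\<bar>"
    using s abs_triangle_ineq[of "(1 - s) * x" "s * y"] by (simp add: abs_mult)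
  then have "\<bar>(1 - s) * x + s * y\<bar> powr q \<le> ((1 - s) * \<bar>x\<bar> + s * \<bar>y\<bar>) powr q"
    using q by (intro powr_mono2) auto
  also have "\<dots> \<le> (1 - s) * \<bar>x\<bar> powr q + s * \<bar>y\<bar> powr q"
  \<comment> \<open>When an argument vanishes, the claim reduces to \<open>t powr q \<le> t\<close>
    on the unit interval; otherwise both arguments are positive and convexity of the power
    applies.\<close>
  proof (cases "x = 0 \<or> y = 0")
    case True
    then show ?thesis
      using le[of "1 - s" "\<bar>x\<bar>"] le[of s "\<bar>y\<bar>"] s by auto
  next
    case False
    then show ?thesis
      using convex_onD[OF powr_convex[OF q], of s "\<bar>x\<bar>" "\<bar>y\<bar>"] s by simp
  qed
  finally show ?thesis .
qed

lemma lq_functional_convex: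
  assumes "1 \<le> q"
  shows "ereal_convex (lq_functional q)"
  unfolding ereal_convex_def lq_functional_le_iff
proof (intro allI impI)
  fix u v :: ell2 and a b s :: real and N :: nat
  assume *: "\<forall>N. (\<Sum>k<N. \<bar>ell2_nth u k\<bar> powr q) \<le> a" "\<forall>N. (\<Sum>k<N. \<bar>ell2_nth v k\<bar> powr q) \<le> b"
    and s: "0 \<le> s" "s \<le> 1"
  have "(\<Sum>k<N. \<bar>ell2_nth ((1 - s) *\<^sub>R u + s *\<^sub>R v) k\<bar> powr q)
      \<le> (\<Sum>k<N. (1 - s) * \<bar>ell2_nth u k\<bar> powr q + s * \<bar>ell2_nth v k\<bar> powr q)"
    unfolding plus_ell2.rep_eq scaleR_ell2.rep_eq by (intro sum_mono abs_powr_convex assms s)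
  also have "\<dots> = (1 - s) * (\<Sum>k<N. \<bar>ell2_nth u k\<bar> powr q) + s * (\<Sum>k<N. \<bar>ell2_nth v k\<bar> powr q)"
    by (simp add: sum.distrib sum_distrib_left)
  also have "\<dots> \<le> (1 - s) * a + s * b"
    using * s by (intro add_mono mult_left_mono) auto
  finally show "(\<Sum>k<N. \<bar>ell2_nth ((1 - s) *\<^sub>R u + s *\<^sub>R v) k\<bar> powr q) \<le> (1 - s) * a + s * b" .
qed

text \<open>Each squared entry is at most \<open>c\<close> times its \<open>q\<close>-th power:
  entries up to 1 by \<open>q \<le> 2\<close>, larger ones because they are themselves at most
  \<open>c\<close>. Summation gives \<open>c * c\<close>.\<close>

lemma lq_functional_coercive:
  assumes q: "1 \<le> q" "q \<le> 2" and c: "1 \<le> c" and le: "lq_functional q u \<le> ereal c"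
  shows "norm u \<le> c"
proof (rule power2_le_imp_le)
  note B = le[unfolded lq_functional_le_iff, rule_format]
  have sq: "(ell2_nth u k)\<^sup>2 \<le> c * \<bar>ell2_nth u k\<bar> powr q" for k
  proof -
    let ?t = "\<bar>ell2_nth u k\<bar>"
    have tq: "?t powr q \<le> c"
      using B[of "Suc k"] sum_nonneg[of "{..<k}" "\<lambda>k. \<bar>ell2_nth u k\<bar> powr q"] by simp
    show ?thesis
    proof (cases "?t \<le> 1")
      case True
      then have "?t\<^sup>2 \<le> ?t powr q"
        using powr_mono'[of q 2 ?t] q by simp
      also have "\<dots> \<le> c * ?t powr q"
        using c mult_right_mono[of 1 c "?t powr q"] by simp
      finally show ?thesis by simp
    next
      case False
      then have "?t \<le> ?t powr q"
        using powr_mono[of 1 q ?t] q by simp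
      then have "?t \<le> c" using tq by simp
      have "?t\<^sup>2 = ?t powr (2 - q) * ?t powr q"
        using False by (simp flip: powr_add)
      also have "\<dots> \<le> ?t * ?t powr q"
        using powr_mono[of "2 - q" 1 ?t] q False by (intro mult_right_mono) auto
      also have "\<dots> \<le> c * ?t powr q"
        using \<open>?t \<le> c\<close> by (intro mult_right_mono) auto
      finally show ?thesis by simp
    qed
  qed
  have "(\<Sum>k<N. (ell2_nth u k)\<^sup>2) \<le> c * c" for N
  proof -
    have "(\<Sum>k<N. (ell2_nth u k)\<^sup>2) \<le> c * (\<Sum>k<N. \<bar>ell2_nth u k\<bar> powr q)"
      unfolding sum_distrib_left by (intro sum_mono sq)
    also have "\<dots> \<le> c * c"
      using B c by (intro mult_left_mono) auto
    finally show ?thesis .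
  qed
  then show "(norm u)\<^sup>2 \<le> c\<^sup>2"
    unfolding norm_ell2_square power2_eq_square[of c]
    by (intro suminf_le_const summable_ell2_nth_square)
qed (use c in simp)

section \<open>Lower semicontinuity and strong convergence\<close>

lemma tendsto_sum_abs_powr:
  assumes "0 < q" and "\<And>k. (\<lambda>n. ell2_nth (x n) k) \<longlonglongrightarrow> ell2_nth u k"
  shows "(\<lambda>n. \<Sum>k<N. \<bar>ell2_nth (x n) k\<bar> powr q) \<longlonglongrightarrow> (\<Sum>k<N. \<bar>ell2_nth u k\<bar> powr q)"
  using assms by (intro tendsto_sum tendsto_powr2 tendsto_rabs tendsto_const) auto

lemma lq_functional_lsc:
  assumes "0 < q" and conv: "\<And>k. (\<lambda>n. ell2_nth (x n) k) \<longlonglongrightarrow> ell2_nth u k"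
    and le: "\<forall>\<^sub>F n in sequentially. lq_functional q (x n) \<le> ereal c"
  shows "lq_functional q u \<le> ereal c"
  unfolding lq_functional_le_iff
proof
  fix N
  show "(\<Sum>k<N. \<bar>ell2_nth u k\<bar> powr q) \<le> c"
  proof (rule tendsto_upperbound)
    show "(\<lambda>n. \<Sum>k<N. \<bar>ell2_nth (x n) k\<bar> powr q) \<longlonglongrightarrow> (\<Sum>k<N. \<bar>ell2_nth u k\<bar> powr q)"
      using assms(1,2) by (rule tendsto_sum_abs_powr)
    show "\<forall>\<^sub>F n in sequentially. (\<Sum>k<N. \<bar>ell2_nth (x n) k\<bar> powr q) \<le> c"
      using le by eventually_elim (simp add: lq_functional_le_iff)
  qed simp
qed

lemma square_le_abs_powr:
  fixes a :: real
  assumes q: "1 \<le> q" "q \<le> 2" and a: "\<bar>a\<bar> powr q \<le> 1"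
  shows "a\<^sup>2 \<le> \<bar>a\<bar> powr q"
proof -
  have "\<bar>a\<bar> \<le> 1"
  proof (rule ccontr)
    assume "\<not> ?thesis"
    then show False
      using powr_mono[of 1 q "\<bar>a\<bar>"] q a by simp
  qed
  then show ?thesis
    using powr_mono'[of q 2 "\<bar>a\<bar>"] q by simp
qed

text \<open>The Radon-Riesz property: no mass escapes to infinity in the limit, so the tails are
  uniformly small in \<open>\<ell>\<^sup>q\<close>, and entries below 1 have squares dominated by their \<open>q\<close>-th powers.\<close>

lemma lq_functional_radon_riesz:
  assumes q: "1 \<le> q" "q \<le> 2"
    and conv: "\<And>k. (\<lambda>n. ell2_nth (x n) k) \<longlonglongrightarrow> ell2_nth u k"
    and c: "lq_functional q u = ereal c"
    and le: "\<And>e. 0 < e \<Longrightarrow> \<forall>\<^sub>F n in sequentially. lq_functional q (x n) \<le> ereal (c + e)"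
  shows "x \<longlonglongrightarrow> u"
proof (rule tendstoI)
  fix e0 :: real
  assume "0 < e0"
  \<comment> \<open>The head costs at most \<open>e\<close> and the tail at most
    \<open>6 * e\<close>, within the budget \<open>9 * e\<close>. The tail powers, at most
    \<open>2 * e\<close>, stay below 1, as \<open>square_le_abs_powr\<close> requires.\<close>
  define e where "e = min 1 (e0\<^sup>2) / 10"
  have e: "0 < e" "4 * e \<le> 1" "9 * e < e0\<^sup>2"
    using \<open>0 < e0\<close> by (auto simp: e_def min_def)
  let ?a = "\<lambda>v k. \<bar>ell2_nth v k\<bar> powr q"
  have "summable (?a u)" and c_eq: "suminf (?a u) = c"
    using c by (auto simp: lq_functional_def split: if_splits)
  then have "(\<lambda>N. \<Sum>k<N. ?a u k) \<longlonglongrightarrow> c"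
    using summable_LIMSEQ by blast
  then have "\<forall>\<^sub>F N in sequentially. c - e < (\<Sum>k<N. ?a u k)"
    using e by (intro order_tendstoD) auto
  then obtain N where N: "c - e < (\<Sum>k<N. ?a u k)"
    using eventually_happens'[OF sequentially_bot] by blast
  have tail: "(\<Sum>k=N..<M. ?a v k) \<le> d - (\<Sum>k<N. ?a v k)"
    if "lq_functional q v \<le> ereal d" "N \<le> M" for v d M
  proof -
    have "(\<Sum>k<M. ?a v k) = (\<Sum>k<N. ?a v k) + (\<Sum>k=N..<M. ?a v k)"
      using sum.atLeastLessThan_concat[of 0 N M "?a v"] that by (simp add: atLeast0LessThan)
    then show ?thesis
      using spec[OF that(1)[unfolded lq_functional_le_iff], of M] by linarith
  qed
  have "\<forall>\<^sub>F n in sequentially. c - e < (\<Sum>k<N. ?a (x n) k)"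
    using tendsto_sum_abs_powr[of q x u N, OF _ conv] q N by (intro order_tendstoD) auto
  moreover have "\<forall>\<^sub>F n in sequentially. (\<Sum>k<N. (ell2_nth (x n) k - ell2_nth u k)\<^sup>2) < e"
  proof -
    have "(\<lambda>n. \<Sum>k<N. (ell2_nth (x n) k - ell2_nth u k)\<^sup>2)
        \<longlonglongrightarrow> (\<Sum>k<N. (ell2_nth u k - ell2_nth u k)\<^sup>2)"
      by (intro tendsto_intros conv)
    then show ?thesis using e by (intro order_tendstoD) auto
  qed
  ultimately show "\<forall>\<^sub>F n in sequentially. dist (x n) u < e0"
    using le[OF e(1)]
  proof eventually_elim
    case (elim n)
    have "(\<Sum>k<M. (ell2_nth (x n - u) k)\<^sup>2) \<le> 9 * e" for M
    proof -
      let ?M = "max M N"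
      \<comment> \<open>The total is at most \<open>c + e\<close> for \<open>x n\<close> and
        \<open>c\<close> for \<open>u\<close>, while both heads exceed \<open>c - e\<close>.\<close>
      have tx: "(\<Sum>k=N..<?M. ?a (x n) k) \<le> 2 * e" and tu: "(\<Sum>k=N..<?M. ?a u k) \<le> e"
        using tail[of "x n" "c + e" ?M] tail[of u c ?M] elim N c by auto
      have le1: "?a v k \<le> 1" if "(\<Sum>k=N..<?M. ?a v k) \<le> 2 * e" "k \<in> {N..<?M}" for v k
        using member_le_sum[of k "{N..<?M}" "?a v"] that e by auto
      have "(ell2_nth (x n) k - ell2_nth u k)\<^sup>2 \<le> 2 * ?a (x n) k + 2 * ?a u k" if "k \<in> {N..<?M}" for k
      proof -
        have "(ell2_nth (x n) k)\<^sup>2 \<le> ?a (x n) k"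
          using le1[OF tx that] q by (intro square_le_abs_powr)
        moreover have "(ell2_nth u k)\<^sup>2 \<le> ?a u k"
          using le1[OF _ that] tu e q by (intro square_le_abs_powr) auto
        moreover have "0 \<le> (ell2_nth (x n) k + ell2_nth u k)\<^sup>2" by simp
        ultimately show ?thesis
          unfolding power2_sum power2_diff by linarith
      qed
      then have "(\<Sum>k=N..<?M. (ell2_nth (x n) k - ell2_nth u k)\<^sup>2)
          \<le> (\<Sum>k=N..<?M. 2 * ?a (x n) k + 2 * ?a u k)"
        by (rule sum_mono)
      also have "\<dots> = 2 * (\<Sum>k=N..<?M. ?a (x n) k) + 2 * (\<Sum>k=N..<?M. ?a u k)"
        by (simp add: sum.distrib sum_distrib_left)
      also have "\<dots> \<le> 6 * e"
        using tx tu by linarith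
      finally have "(\<Sum>k=N..<?M. (ell2_nth (x n) k - ell2_nth u k)\<^sup>2) \<le> 6 * e" .
      moreover have "(\<Sum>k<M. (ell2_nth (x n) k - ell2_nth u k)\<^sup>2)
          \<le> (\<Sum>k<?M. (ell2_nth (x n) k - ell2_nth u k)\<^sup>2)"
        by (intro sum_mono2) auto
      moreover have "(\<Sum>k<?M. (ell2_nth (x n) k - ell2_nth u k)\<^sup>2)
          = (\<Sum>k<N. (ell2_nth (x n) k - ell2_nth u k)\<^sup>2)
            + (\<Sum>k=N..<?M. (ell2_nth (x n) k - ell2_nth u k)\<^sup>2)"
        using sum.atLeastLessThan_concat[of 0 N ?M "\<lambda>k. (ell2_nth (x n) k - ell2_nth u k)\<^sup>2"]
        by (simp add: atLeast0LessThan)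
      ultimately show ?thesis
        using elim(2) e by (simp add: minus_ell2.rep_eq)
    qed
    then have "(norm (x n - u))\<^sup>2 \<le> 9 * e"
      unfolding norm_ell2_square by (intro suminf_le_const summable_ell2_nth_square)
    then have "(norm (x n - u))\<^sup>2 < e0\<^sup>2"
      using e by linarith
    then show ?case
      using \<open>0 < e0\<close> by (simp add: dist_norm power2_less_imp_less)
  qed
qed

section \<open>Minimizing solutions and convergence\<close>

text \<open>Coercivity bounds the norms, so a subsequence converges componentwise and hence weakly.
  Pairing with every \<open>h\<close> identifies \<open>K u\<close>, since
  \<open>inner h (K v)\<close> is a bounded functional of \<open>v\<close>.\<close>

lemma ell2_compactness:
  fixes K :: "ell2 \<Rightarrow> 'b::real_inner"
  assumes K: "bounded_linear K" and q: "1 \<le> q" "q \<le> 2"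
    and le: "\<forall>\<^sub>F n in sequentially. lq_functional q (x n) \<le> ereal c"
    and Kx: "(\<lambda>n. K (x n)) \<longlonglongrightarrow> g"
  obtains r u where "strict_mono (r :: nat \<Rightarrow> nat)" "K u = g"
    "\<And>k. (\<lambda>n. ell2_nth (x (r n)) k) \<longlonglongrightarrow> ell2_nth u k"
proof -
  obtain N where N: "\<And>n. N \<le> n \<Longrightarrow> lq_functional q (x n) \<le> ereal c"
    using le by (auto simp: eventually_sequentially)
  \<comment> \<open>Shifting by \<open>N\<close> turns the eventual bound into one for all indices;
    coercivity asks for a bound of at least 1.\<close>
  have bound: "norm (x (n + N)) \<le> max 1 c" for n
  proof (rule lq_functional_coercive[OF q])
    show "lq_functional q (x (n + N)) \<le> ereal (max 1 c)"
      using order_trans[OF N[of "n + N"], of "ereal (max 1 c)"] by simp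
  qed simp
  obtain r u where r: "strict_mono (r :: nat \<Rightarrow> nat)"
      and u: "\<And>k. (\<lambda>n. ell2_nth (x (r n + N)) k) \<longlonglongrightarrow> ell2_nth u k"
    using ell2_componentwise_convergent_subsequence[of "\<lambda>n. x (n + N)", OF bound] by blast
  have r': "strict_mono (\<lambda>n. r n + N)"
    using r by (simp add: strict_mono_def)
  have "inner h (K u) = inner h g" for h
  proof (rule LIMSEQ_unique)
    have "bounded_linear (\<lambda>v. inner h (K v))"
      using bounded_linear_compose[OF bounded_linear_inner_right K] .
    then show "(\<lambda>n. inner h (K (x (r n + N)))) \<longlonglongrightarrow> inner h (K u)"
      by (rule ell2_weakly_convergent[OF _ u bound])
    show "(\<lambda>n. inner h (K (x (r n + N)))) \<longlonglongrightarrow> inner h g"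
      using LIMSEQ_subseq_LIMSEQ[OF Kx r'] by (intro tendsto_inner tendsto_const) (simp add: o_def)
  qed
  then have "K u = g"
    using vector_eq_ldot[of "K u" g] by blast
  with r' u show ?thesis by (intro that) auto
qed

text \<open>Supplies the semicontinuity hypothesis of \<open>ex_almost_dual_optimal\<close>: a
  subsequence violating it would have a weak cluster point solving the equation with penalty at most
  \<open>b - e\<close>.\<close>

lemma lq_functional_eventually_ge_on_solutions:
  fixes K :: "ell2 \<Rightarrow> 'b::real_inner"
  assumes K: "bounded_linear K" and q: "1 \<le> q" "q \<le> 2"
    and min: "\<And>v. K v = g \<Longrightarrow> \<not> lq_functional q v < ereal b"
    and Kx: "(\<lambda>n. K (x n)) \<longlonglongrightarrow> g" and "0 < e"
  shows "\<forall>\<^sub>F n in sequentially. \<not> lq_functional q (x n) \<le> ereal (b - e)"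
proof (rule ccontr)
  assume "\<not> ?thesis"
  then obtain s where s: "strict_mono (s :: nat \<Rightarrow> nat)"
      and le: "\<And>n. lq_functional q (x (s n)) \<le> ereal (b - e)"
    using not_eventually_sequentiallyD by blast
  have Kxs: "(\<lambda>n. K (x (s n))) \<longlonglongrightarrow> g"
    using LIMSEQ_subseq_LIMSEQ[OF Kx s] by (simp add: o_def)
  then obtain r u where "strict_mono (r :: nat \<Rightarrow> nat)" and Ku: "K u = g"
      and u: "\<And>k. (\<lambda>n. ell2_nth (x (s (r n))) k) \<longlonglongrightarrow> ell2_nth u k"
    using ell2_compactness[OF K q always_eventually[OF allI[OF le]] Kxs] by blast
  have "lq_functional q u \<le> ereal (b - e)"
    using q le by (intro lq_functional_lsc[OF _ u]) auto
  also have "\<dots> < ereal b"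
    using \<open>0 < e\<close> by simp
  finally show False
    using min[OF Ku] by simp
qed

text \<open>The direct method: a minimizing sequence of exact solutions has a weak cluster point,
  and the penalty is lower semicontinuous. Only finite values are collected in \<open>S\<close>, so
  that the infimum is real.\<close>

lemma ex_J_minimizing_solution:
  fixes K :: "ell2 \<Rightarrow> 'b::real_inner"
  assumes K: "bounded_linear K" and q: "1 \<le> q" "q \<le> 2"
    and att: "attainable K (lq_functional q) g"
  obtains u b where "J_minimizing_solution K (lq_functional q) g u" "lq_functional q u = ereal b"
proof -
  let ?J = "lq_functional q"
  have finite: "\<exists>b. ?J v = ereal b" if "?J v < \<infinity>" for v
    using that lq_functional_nonneg[of q v] by (cases "?J v") auto
  define S where "S = {b. \<exists>v. K v = g \<and> ?J v = ereal b}"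
  have "S \<noteq> {}"
    using att finite unfolding attainable_def S_def by blast
  have "bdd_below S"
  proof
    fix b assume "b \<in> S"
    then obtain v where "?J v = ereal b"
      by (auto simp: S_def)
    then show "0 \<le> b"
      using lq_functional_nonneg[of q v] by simp
  qed
  have "\<exists>v. K v = g \<and> ?J v \<le> ereal (Inf S + 1 / Suc n)" for n
  proof -
    have "Inf S < Inf S + 1 / Suc n" by simp
    then obtain b where "b \<in> S" and b: "b < Inf S + 1 / Suc n"
      using cInf_less_iff[OF \<open>S \<noteq> {}\<close> \<open>bdd_below S\<close>] by blast
    then obtain v where "K v = g" "?J v = ereal b"
      unfolding S_def by blast
    with b show ?thesis
      by (intro exI[of _ v]) simp
  qed
  then have "\<forall>n. \<exists>v. K v = g \<and> ?J v \<le> ereal (Inf S + 1 / Suc n)" ..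
  from choice[OF this]
  obtain x where x: "\<And>n. K (x n) = g" "\<And>n. ?J (x n) \<le> ereal (Inf S + 1 / Suc n)"
    by blast
  have le: "\<forall>\<^sub>F n in sequentially. ?J (x n) \<le> ereal (Inf S + e)" if "0 < e" for e
  proof -
    have "\<forall>\<^sub>F n in sequentially. inverse (real (Suc n)) < e"
      using order_tendstoD(2)[OF LIMSEQ_inverse_real_of_nat that] .
    then show ?thesis
    proof eventually_elim
      case (elim n)
      then show ?case
        by (intro order_trans[OF x(2)[of n]]) (simp add: inverse_eq_divide)
    qed
  qed
  have Kx: "(\<lambda>n. K (x n)) \<longlonglongrightarrow> g"
    by (simp add: x(1))
  obtain r u where r: "strict_mono (r :: nat \<Rightarrow> nat)" and Ku: "K u = g"
      and u: "\<And>k. (\<lambda>n. ell2_nth (x (r n)) k) \<longlonglongrightarrow> ell2_nth u k"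
    using ell2_compactness[OF K q le[OF zero_less_one] Kx] by blast
  have "?J u \<le> ereal (Inf S) + ereal e" if "0 < e" for e
    using lq_functional_lsc[OF _ u eventually_subseq[OF r le[OF that]]] q by simp
  then have Ju: "?J u \<le> ereal (Inf S)"
    by (simp add: ereal_le_epsilon2)
  have "\<not> ?J v < ?J u" if "K v = g" for v
  proof
    assume less: "?J v < ?J u"
    then have "?J v < \<infinity>"
      by (rule less_le_trans) simp
    then obtain b where b: "?J v = ereal b"
      using finite by blast
    with that have "b \<in> S"
      unfolding S_def by blast
    then have "Inf S \<le> b"
      using \<open>bdd_below S\<close> by (rule cInf_lower)
    then have "ereal (Inf S) \<le> ?J v"
      by (simp add: b)
    from order_trans[OF Ju this] less show False
      by simp
  qed
  then have "J_minimizing_solution K ?J g u"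
    using Ku by (auto simp: J_minimizing_solution_def is_arg_min_def)
  moreover obtain b where "?J u = ereal b"
    using finite[OF le_less_trans[OF Ju]] by auto
  ultimately show ?thesis by (rule that)
qed

theorem theorem6p1:
  fixes K :: "ell2 \<Rightarrow> 'b::{real_inner, complete_space}"
    and q :: real and g p0 :: 'b and \<tau> :: "nat \<Rightarrow> real"
    and R :: "nat \<Rightarrow> 'b \<Rightarrow> ell2" and \<Gamma> :: "real \<Rightarrow> 'b \<Rightarrow> nat"
    and \<delta> :: "nat \<Rightarrow> real" and gs :: "nat \<Rightarrow> 'b"
  assumes "separable_space (euclidean :: 'b topology)"
    and "bounded_linear K"
    and "1 \<le> q" and "q \<le> 2"
    and "attainable K (lq_functional q) g"
    and "\<forall>n\<ge>1. \<tau> n > 0"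
    and "filterlim (ALM_time \<tau>) at_top sequentially"
    and "bdd_above (\<tau> ` {1..})"
    and "ALM_regularization K (lq_functional q) \<tau> p0 R"
    and "\<forall>k. \<delta> k > 0" and "\<delta> \<longlonglongrightarrow> 0"
    and "\<forall>k. norm (gs k - g) \<le> \<delta> k"
    and "(\<lambda>k. (\<delta> k)\<^sup>2 * ALM_time \<tau> (\<Gamma> (\<delta> k) (gs k))) \<longlonglongrightarrow> 0"
    and "filterlim (\<lambda>k. ALM_time \<tau> (\<Gamma> (\<delta> k) (gs k))) at_top sequentially"
  shows "\<exists>r u. strict_mono (r :: nat \<Rightarrow> nat) \<and>
    J_minimizing_solution K (lq_functional q) g u \<and>
    (\<lambda>k. R (\<Gamma> (\<delta> (r k)) (gs (r k))) (gs (r k))) \<longlonglongrightarrow> u"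
proof -
  let ?J = "lq_functional q"
  note K = assms(2) and q = assms(3,4)
  define n where "n k = \<Gamma> (\<delta> k) (gs k)" for k
  define x where "x k = R (n k) (gs k)" for k
  obtain v b where min: "J_minimizing_solution K ?J g v" and Jv: "?J v = ereal b"
    using ex_J_minimizing_solution[OF K q assms(5)] .
  from min have Kv: "K v = g" and b_le: "\<And>w. K w = g \<Longrightarrow> \<not> ?J w < ereal b"
    by (auto simp: J_minimizing_solution_def is_arg_min_def Jv)
  obtain p where p: "\<And>f. ALM_iterates K ?J \<tau> p0 f (\<lambda>n. R n f) (p f)"
    using assms(9) unfolding ALM_regularization_def by metis
  have alm: "ALM K ?J \<tau> p0 f (\<lambda>n. R n f) (p f)" for f
  proof (rule ALM.intro)
    show "linear K"
      using K by (rule bounded_linear.linear)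
    show "\<exists>v. ?J v < \<infinity>"
      using assms(5) by (auto simp: attainable_def)
    show "ALM_iterates K ?J \<tau> p0 f (\<lambda>n. R n f) (p f)"
      by (rule p)
  qed (use assms(6) q lq_functional_convex lq_functional_nonneg in auto)
  \<comment> \<open>Here the method is run with the exact data \<open>g\<close>, for which
    \<open>v\<close> is a solution.\<close>
  have dual: "\<exists>p'. almost_dual_optimal K ?J g b e p'" if "0 < e" for e
    using that Jv
    by (intro ALM.ex_almost_dual_optimal[OF alm assms(7) Kv]
        lq_functional_eventually_ge_on_solutions[OF K q b_le]) auto
  have noise: "norm (gs k - g) \<le> \<delta> k" for k
    using assms(12) by blast
  have "?J v \<le> ereal b" using Jv by simp
  note asymptotics = ALM_regularization_asymptotics[OF alm assms(11) noise
      assms(14)[folded n_def] assms(13)[folded n_def] Kv this, folded x_def]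
  have Kx: "(\<lambda>k. K (x k)) \<longlonglongrightarrow> g"
    using asymptotics(1) dual by blast
  have lim: "\<forall>\<^sub>F k in sequentially. ?J (x k) \<le> ereal (b + e)" if "0 < e" for e
    using asymptotics(2) dual that by blast
  obtain r u where r: "strict_mono (r :: nat \<Rightarrow> nat)" and Ku: "K u = g"
      and u: "\<And>k. (\<lambda>n. ell2_nth (x (r n)) k) \<longlonglongrightarrow> ell2_nth u k"
    using ell2_compactness[OF K q lim[OF zero_less_one] Kx] by blast
  have le: "\<forall>\<^sub>F k in sequentially. ?J (x (r k)) \<le> ereal (b + e)" if "0 < e" for e
    using eventually_subseq[OF r lim[OF that]] .
  have "?J u \<le> ereal b + ereal e" if "0 < e" for e
    using lq_functional_lsc[OF _ u le[OF that]] q by simp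
  then have "?J u \<le> ereal b"
    by (simp add: ereal_le_epsilon2)
  \<comment> \<open>Equality matters: the Radon-Riesz property needs the penalties to be
    asymptotically no larger than that of the limit.\<close>
  then have Ju: "?J u = ereal b"
    using b_le[OF Ku] by simp
  then have "J_minimizing_solution K ?J g u"
    using Ku b_le by (auto simp: J_minimizing_solution_def is_arg_min_def)
  moreover have "(\<lambda>k. x (r k)) \<longlonglongrightarrow> u"
    using lq_functional_radon_riesz[OF q u Ju le] .
  ultimately show ?thesis
    using r unfolding x_def n_def by blast
qed

end
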